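(* Let $\alpha\ge -1$ be a real number. For $n\ge 0$ let $$\widetilde L^{(\alpha)}_n(q)=\sum_{k=0}^n\binom{n+\alpha}{n-k}\frac{n!}{k!}q^k,\qquad \widetilde L^{(\alpha)*}_n(q)=q^n\widetilde L^{(\alpha)}_n(1/q).$$ Then: (i) both $(\widetilde L^{(\alpha)}_n(q))_{n\ge 0}$ and $(\widetilde L^{(\alpha)*}_n(q))_{n\ge 0}$ are $q$-Stieltjes moment and $3$-$q$-log-convex; (ii) the triangular matrix $\big[\binom{n+\alpha}{n-k}\frac{n!}{k!}\big]_{n,k\ge 0}$ is TP; (iii) the convolution $z_n=\sum_{k\ge 0}\binom{n+\alpha}{n-k}\frac{n!}{k!}x_ky_{n-k}$ preserves the SM property.
   Context: $\widetilde L^{(\alpha)}_n(q)=L^{(\alpha)}_n(-q)$ is the signless Laguerre polynomial, where $\sum_{n\ge0}L^{(\alpha)}_n(q)\frac{t^n}{n!}=\frac{1}{(1-t)^{\alpha+1}}\exp\big(\frac{qt}{t-1}\big)$. Here $\binom{x}{j}=x(x-1)\cdots(x-j+1)/j!$ for integers $j\ge 0$, and $\binom{x}{j}=0$ for $j<0$. A real matrix is TP if all its minors are nonnegative. A sequence $(\alpha_n(q))_{n\ge 0}$ in $\mathbb{R}[q]$ is $q$-Stieltjes moment if all minors of $[\alpha_{i+j}(q)]_{i,j\ge 0}$ are polynomials with nonnegative coefficients. Let $\mathcal{L}[\alpha_i]=\alpha_{i-1}\alpha_{i+1}-\alpha_i^2$ for $i\ge 1$ and $\mathcal{L}^m=\mathcal{L}(\mathcal{L}^{m-1})$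 (so $\mathcal{L}^m[\alpha_i]$ is defined for $i\ge m$); the sequence is $3$-$q$-log-convex if for $m=1,2,3$ all $\mathcal{L}^m[\alpha_i]$ have nonnegative coefficients. A real sequence $(a_k)_{k\ge 0}$ is SM (Stieltjes moment) if $a_k=\int_0^{+\infty}x^k\,d\mu(x)$ for a nonnegative measure $\mu$ on $[0,+\infty)$. A convolution preserves the SM property if $(z_n)_{n\ge 0}$ is SM whenever $(x_n)_{n\ge 0}$ and $(y_n)_{n\ge 0}$ both are (only terms with $0\le k\le n$ occur in the sum). *)

theory Defs
  imports
    "HOL-Analysis.Bochner_Integration"
    "HOL-Computational_Algebra.Polynomial"
    "Jordan_Normal_Form.Determinant"
begin

definition int_gbinomial :: "real \<Rightarrow> int \<Rightarrow> real" where
  "int_gbinomial x j = (if j < 0 then 0 else x gchoose nat j)"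

definition laguerre_coeff :: "real \<Rightarrow> nat \<Rightarrow> nat \<Rightarrow> real" where
  "laguerre_coeff \<alpha> n k = int_gbinomial (real n + \<alpha>) (int n - int k) * (fact n / fact k)"

text \<open>The signless Laguerre polynomial \<open>L\<^sub>n\<^sup>(\<^sup>\<alpha>\<^sup>)(-q)\<close>, normalised so that its exponential
  generating function is \<open>exp (q t / (1 - t)) / (1 - t) powr (\<alpha> + 1)\<close>; it is monic of
  degree \<open>n\<close>.\<close>

definition signless_laguerre :: "real \<Rightarrow> nat \<Rightarrow> real poly" where
  "signless_laguerre \<alpha> n = (\<Sum>k\<le>n. monom (laguerre_coeff \<alpha> n k) k)"

text \<open>\<^const>\<open>reflect_poly\<close> reverses with respect to the degree of its argument. That degree is \<open>n\<close>
  here, so this is \<open>q^n\<close> times the polynomial at \<open>1/q\<close>, also where the constant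
  coefficient vanishes (\<open>\<alpha> = -1\<close>); see \<open>poly_signless_laguerre_rev\<close>.\<close>

definition signless_laguerre_rev :: "real \<Rightarrow> nat \<Rightarrow> real poly" where
  "signless_laguerre_rev \<alpha> n = reflect_poly (signless_laguerre \<alpha> n)"

lemma coeff_signless_laguerre: "coeff (signless_laguerre \<alpha> n) k = laguerre_coeff \<alpha> n k"
proof -
  have "laguerre_coeff \<alpha> n k = 0" if "k > n"
    using that by (simp add: laguerre_coeff_def int_gbinomial_def)
  then show ?thesis
    by (auto simp: signless_laguerre_def coeff_sum sum.delta)
qed

lemma degree_signless_laguerre: "degree (signless_laguerre \<alpha> n) = n"
proof (rule antisym)
  show "degree (signless_laguerre \<alpha> n) \<le> n"
    by (rule degree_le)
      (simp add: coeff_signless_laguerre laguerre_coeff_def int_gbinomial_def)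
  show "n \<le> degree (signless_laguerre \<alpha> n)"
    by (rule le_degree)
      (simp add: coeff_signless_laguerre laguerre_coeff_def int_gbinomial_def)
qed

lemma poly_signless_laguerre_rev:
  "q \<noteq> 0 \<Longrightarrow> poly (signless_laguerre_rev \<alpha> n) q = q ^ n * poly (signless_laguerre \<alpha> n) (1 / q)"
  by (simp add: signless_laguerre_rev_def poly_reflect_poly_nz degree_signless_laguerre
      inverse_eq_divide)

text \<open>Infinite matrices are functions \<open>nat \<Rightarrow> nat \<Rightarrow> 'a\<close>; a minor is given by strictly increasing
  choices of \<open>r\<close> rows and \<open>r\<close> columns (\<open>r = 0\<close> contributes the harmless value \<open>1\<close>).\<close>

definition minors :: "(nat \<Rightarrow> nat \<Rightarrow> 'a :: comm_ring_1) \<Rightarrow> 'a set" where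
  "minors A = {Determinant.det (Matrix.mat r r (\<lambda>(i, j). A (\<rho> i) (\<sigma> j))) | r \<rho> \<sigma>.
     strict_mono_on {..<r} \<rho> \<and> strict_mono_on {..<r} \<sigma>}"

definition totally_positive :: "(nat \<Rightarrow> nat \<Rightarrow> real) \<Rightarrow> bool" where
  "totally_positive A \<longleftrightarrow> (\<forall>d \<in> minors A. 0 \<le> d)"

text \<open>Not the order of the type class on \<open>real poly\<close>, which only looks at leading coefficients.\<close>

definition nonneg_coeffs :: "real poly \<Rightarrow> bool" where
  "nonneg_coeffs p \<longleftrightarrow> (\<forall>k. 0 \<le> coeff p k)"

definition q_Stieltjes_moment :: "(nat \<Rightarrow> real poly) \<Rightarrow> bool" where
  "q_Stieltjes_moment a \<longleftrightarrow> (\<forall>d \<in> minors (\<lambda>i j. a (i + j)). nonneg_coeffs d)"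

text \<open>Meaningful for \<open>i \<ge> 1\<close> only; consequently its \<open>m\<close>-th iterate is meaningful for
  \<open>i \<ge> m\<close>, and at such \<open>i\<close> the truncated subtraction is never used at \<open>0\<close>.\<close>

definition log_convexity_op :: "(nat \<Rightarrow> real poly) \<Rightarrow> nat \<Rightarrow> real poly" where
  "log_convexity_op a i = a (i - 1) * a (i + 1) - (a i)\<^sup>2"

definition three_q_log_convex :: "(nat \<Rightarrow> real poly) \<Rightarrow> bool" where
  "three_q_log_convex a \<longleftrightarrow>
     (\<forall>m \<in> {1..3}. \<forall>i \<ge> m. nonneg_coeffs ((log_convexity_op ^^ m) a i))"

definition Stieltjes_moment :: "(nat \<Rightarrow> real) \<Rightarrow> bool" where
  "Stieltjes_moment a \<longleftrightarrow>
     (\<exists>\<mu> :: real measure. sets \<mu> = sets (restrict_space borel {0..}) \<and>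
        (\<forall>k. has_bochner_integral \<mu> (\<lambda>x. x ^ k) (a k)))"

definition convolution :: "(nat \<Rightarrow> nat \<Rightarrow> real) \<Rightarrow> (nat \<Rightarrow> real) \<Rightarrow> (nat \<Rightarrow> real) \<Rightarrow> nat \<Rightarrow> real" where
  "convolution A x y n = (\<Sum>k\<le>n. A n k * x k * y (n - k))"

definition convolution_preserves_SM :: "(nat \<Rightarrow> nat \<Rightarrow> real) \<Rightarrow> bool" where
  "convolution_preserves_SM A \<longleftrightarrow>
     (\<forall>x y. Stieltjes_moment x \<longrightarrow> Stieltjes_moment y \<longrightarrow> Stieltjes_moment (convolution A x y))"

end

theory Submission
  imports Defs "HOL-Analysis.Gamma_Function"
begin

text \<open>Write \<open>q\<close> for the variable, \<open>D\<close> for differentiation, and \<open>L\<^sub>n\<close> for the signless Laguerre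
  polynomials. The statement has three sources.

  Total positivity. If each column of a matrix is replaced by a nonnegative combination of itself
  and its neighbour on one side, the same side for all columns, then every minor of the new
  matrix is a nonnegative combination of old minors (\<open>TP_mix_columns\<close>). All matrices
  needed here arise from the identity matrix by such bidiagonal operations on rows and columns, where ``nonnegative'' means coefficientwise nonnegative if
  the entries are polynomials. A weighted Pascal matrix is an infinite product of them
  (\<open>TP_pascal_mult\<close>), and the Laguerre triangle is the one with weights \<open>n + \<alpha>\<close>. For the
  Hankel matrix, the idea is the recurrence
  \<open>(1 + D)\<^sup>s L\<^bsub>n+1\<^esub> = (s + \<alpha> + 1) (1 + D)\<^bsup>s+1\<^esup> L\<^sub>n + q (1 + D)\<^bsup>s+2\<^esup> L\<^sub>n\<close>.
  The matrix with entries \<open>(1 + D)\<^sup>s L\<^sub>n\<close> comes from the identity through three weighted Pascal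
  matrices, and the recurrence says that bidiagonal column operations transform it into
  \<open>L\<^bsub>i + j\<^esub>\<close>, one column at a time (\<open>q_Stieltjes_moment_signless_laguerre\<close>). For the reversed
  polynomials, each Hankel minor is the reversal of the original one up to a power of \<open>q\<close>.

  Log-convexity. For every \<open>q\<close>-Stieltjes moment sequence, the first three iterates of the
  log-convexity operator are sums of products of Hankel minors of size at most \<open>4\<close>, by Dodgson
  condensation (\<open>three_q_log_convex_if_q_Stieltjes_moment\<close>).

  The convolution. By the Dobinski formula
  \<open>L\<^sub>n(q) = e\<^bsup>-q\<^esup> \<Sum>\<^sub>m q\<^sup>m / m! * pochhammer (m + \<alpha> + 1) n\<close> (\<open>dobinski_laguerre\<close>), the value of \<open>L\<^sub>n\<close> at
  \<open>q \<ge> 0\<close> is the \<open>n\<close>-th moment of a Poisson mixture of gamma distributions. The convolution of the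
  moments of \<open>\<mu>\<close> and \<open>\<nu>\<close> averages \<open>y\<^sup>n L\<^sub>n(x / y)\<close> over \<open>\<mu> \<Otimes>\<^sub>M \<nu>\<close>, and so it is the moment
  sequence of a mixture of rescaled such distributions.\<close>

section \<open>Minors over a cone of nonnegative elements\<close>

definition minor :: "(nat \<Rightarrow> nat \<Rightarrow> 'a::comm_ring_1) \<Rightarrow> nat \<Rightarrow> (nat \<Rightarrow> nat) \<Rightarrow> (nat \<Rightarrow> nat) \<Rightarrow> 'a" where
  "minor A r \<rho> \<sigma> = det (mat r r (\<lambda>(i, j). A (\<rho> i) (\<sigma> j)))"

lemma det_column_linear:
  fixes M :: "nat \<Rightarrow> nat \<Rightarrow> 'a::comm_ring_1"
  assumes t: "t < r"
  shows "det (mat r r (\<lambda>(i, j). if j = t then c * u i + d * v i else M i j)) =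
         c * det (mat r r (\<lambda>(i, j). if j = t then u i else M i j)) +
         d * det (mat r r (\<lambda>(i, j). if j = t then v i else M i j))"
proof -
  define N where "N x = mat r r (\<lambda>(i, j). if j = t then x i else M i j)" for x :: "nat \<Rightarrow> 'a"
  have cof: "cofactor (N x) i t = cofactor (N (\<lambda>_. 0)) i t" if "i < r" for x i
  proof -
    have "mat_delete (N x) i t = mat_delete (N (\<lambda>_. 0)) i t"
      unfolding mat_delete_def N_def by (rule eq_matI) (use t in auto)
    then show ?thesis by (simp add: cofactor_def)
  qed
  have ex: "det (N x) = (\<Sum>i<r. x i * cofactor (N (\<lambda>_. 0)) i t)" for x
  proof -
    have "N x \<in> carrier_mat r r" by (simp add: N_def)
    then have "det (N x) = (\<Sum>i<r. N x $$ (i, t) * cofactor (N x) i t)"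
      by (rule laplace_expansion_column) (rule t)
    also have "\<dots> = (\<Sum>i<r. x i * cofactor (N (\<lambda>_. 0)) i t)"
    proof (rule sum.cong[OF refl])
      fix i assume "i \<in> {..<r}"
      then show "N x $$ (i, t) * cofactor (N x) i t = x i * cofactor (N (\<lambda>_. 0)) i t"
        using cof[of i x] t by (simp add: N_def)
    qed
    finally show ?thesis .
  qed
  have "det (N (\<lambda>i. c * u i + d * v i)) = c * det (N u) + d * det (N v)"
    unfolding ex by (simp add: sum.distrib sum_distrib_left algebra_simps)
  then show ?thesis by (simp add: N_def)
qed

lemma det_zero_column:
  fixes A :: "'a::comm_ring_1 mat"
  assumes "A \<in> carrier_mat r r" "t < r" "\<And>i. i < r \<Longrightarrow> A $$ (i, t) = 0"
  shows "det A = 0"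
  using laplace_expansion_column[OF assms(1,2)] assms(3) by simp

lemma minor_transpose: "minor (\<lambda>i j. A j i) r \<rho> \<sigma> = minor A r \<sigma> \<rho>"
proof -
  have "mat r r (\<lambda>(i, j). A (\<sigma> j) (\<rho> i)) = transpose_mat (mat r r (\<lambda>(i, j). A (\<sigma> i) (\<rho> j)))"
    by (rule eq_matI) auto
  then show ?thesis
    using det_transpose[of "mat r r (\<lambda>(i, j). A (\<sigma> i) (\<rho> j))" r] by (simp add: minor_def)
qed

lemma minor_cong:
  assumes "\<And>i j. i < r \<Longrightarrow> j < r \<Longrightarrow> A (\<rho> i) (\<sigma> j) = B (\<rho>' i) (\<sigma>' j)"
  shows "minor A r \<rho> \<sigma> = minor B r \<rho>' \<sigma>'"
  unfolding minor_def by (rule arg_cong[where f = det]) (use assms in \<open>auto intro!: eq_matI\<close>)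

text \<open>The same argument is needed for real matrices (nonnegative minors) and for matrices of
  polynomials (minors with nonnegative coefficients). All it uses is closure under sums and
  products.\<close>

locale nonneg_cone =
  fixes P :: "'a::comm_ring_1 set"
  assumes zero_mem: "0 \<in> P" and one_mem: "1 \<in> P"
    and add_mem: "x \<in> P \<Longrightarrow> y \<in> P \<Longrightarrow> x + y \<in> P"
    and mult_mem: "x \<in> P \<Longrightarrow> y \<in> P \<Longrightarrow> x * y \<in> P"
begin

definition TP :: "(nat \<Rightarrow> nat \<Rightarrow> 'a) \<Rightarrow> bool" where
  "TP A \<longleftrightarrow> minors A \<subseteq> P"

lemma TP_iff:
  "TP A \<longleftrightarrow> (\<forall>r \<rho> \<sigma>. strict_mono_on {..<r} \<rho> \<longrightarrow> strict_mono_on {..<r} \<sigma> \<longrightarrow> minor A r \<rho> \<sigma> \<in> P)"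
  unfolding TP_def minors_def minor_def by blast

lemma TP_transpose: "TP A \<Longrightarrow> TP (\<lambda>i j. A j i)"
  unfolding TP_iff using minor_transpose[of A] by metis

lemma TP_minor_weakly_increasing_columns:
  assumes A: "TP A" and \<rho>: "strict_mono_on {..<r} \<rho>"
    and \<kappa>: "\<And>i j. i < j \<Longrightarrow> j < r \<Longrightarrow> \<kappa> i \<le> \<kappa> j"
  shows "minor A r \<rho> \<kappa> \<in> P"
proof (cases "inj_on \<kappa> {..<r}")
  case True
  have "strict_mono_on {..<r} \<kappa>"
  proof (rule strict_mono_onI)
    fix i j assume ij: "i \<in> {..<r}" "j \<in> {..<r}" "i < j"
    have "\<kappa> i \<noteq> \<kappa> j" using True ij by (metis inj_onD nat_neq_iff)
    then show "\<kappa> i < \<kappa> j" using \<kappa>[of i j] ij by simp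
  qed
  then show ?thesis using A \<rho> unfolding TP_iff by blast
next
  case False
  then obtain i j where ij: "i < r" "j < r" "i \<noteq> j" "\<kappa> i = \<kappa> j"
    unfolding inj_on_def by auto
  have "minor A r \<rho> \<kappa> = 0"
    unfolding minor_def
    by (rule det_identical_columns[of _ r i j]) (use ij in \<open>auto intro!: eq_vecI\<close>)
  then show ?thesis by (simp add: zero_mem)
qed

text \<open>A minor of the new matrix is linear in each of its columns, so it is a combination, with
  coefficients in the cone, of determinants in which the \<open>j\<close>-th column is column \<open>f j\<close> or column
  \<open>g j\<close> of \<open>A\<close>. The interlacing \<open>g i \<le> f j\<close> for \<open>i < j\<close> keeps the chosen columns in weakly
  increasing order, and so each such determinant is a minor of \<open>A\<close> or has a repeated column.
  The typical case is multiplication by a bidiagonal matrix, where \<open>f\<close> and \<open>g\<close> pick neighbouring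
  columns.\<close>

lemma TP_mix_columns:
  assumes A: "TP A" and d: "\<And>j. d j \<in> P" and e: "\<And>j. e j \<in> P"
    and fg: "\<And>j. f j \<le> g j" and gf: "\<And>i j. i < j \<Longrightarrow> g i \<le> f j"
  shows "TP (\<lambda>i j. d j * A i (f j) + e j * A i (g j))"
  unfolding TP_iff
proof (intro allI impI)
  fix r and \<rho> \<sigma> :: "nat \<Rightarrow> nat"
  assume \<rho>: "strict_mono_on {..<r} \<rho>" and \<sigma>: "strict_mono_on {..<r} \<sigma>"
  let ?B = "\<lambda>i j. d j * A i (f j) + e j * A i (g j)"
  \<comment> \<open>Expand one column at a time: the columns from \<open>t\<close> on have already been split.\<close>
  have step: "det (mat r r (\<lambda>(i, j). if j < t then ?B (\<rho> i) (\<sigma> j) else A (\<rho> i) (\<kappa> j))) \<in> P"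
    if "t \<le> r" "\<And>j. j < r \<Longrightarrow> \<kappa> j = f (\<sigma> j) \<or> \<kappa> j = g (\<sigma> j)" for t \<kappa>
    using that
  proof (induction t arbitrary: \<kappa>)
    case 0
    have "\<kappa> i \<le> \<kappa> j" if "i < j" "j < r" for i j
    proof -
      have "\<sigma> i < \<sigma> j" using \<sigma> that by (auto simp: strict_mono_on_def)
      then show ?thesis
        using "0.prems"(2)[of i] "0.prems"(2)[of j] that fg[of "\<sigma> i"] fg[of "\<sigma> j"] gf[of "\<sigma> i" "\<sigma> j"]
        by auto
    qed
    then show ?case
      using TP_minor_weakly_increasing_columns[OF A \<rho>, of \<kappa>] by (simp add: minor_def)
  next
    case (Suc t)
    let ?M = "\<lambda>i j. if j < t then ?B (\<rho> i) (\<sigma> j) else A (\<rho> i) (\<kappa> j)"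
    have eq: "mat r r (\<lambda>(i, j). if j < Suc t then ?B (\<rho> i) (\<sigma> j) else A (\<rho> i) (\<kappa> j)) =
       mat r r (\<lambda>(i, j). if j = t then d (\<sigma> t) * A (\<rho> i) (f (\<sigma> t)) + e (\<sigma> t) * A (\<rho> i) (g (\<sigma> t))
                         else ?M i j)"
      by (rule eq_matI) (auto simp: less_Suc_eq)
    have IH: "det (mat r r (\<lambda>(i, j). if j = t then A (\<rho> i) c else ?M i j)) \<in> P"
      if "c = f (\<sigma> t) \<or> c = g (\<sigma> t)" for c
    proof -
      have "mat r r (\<lambda>(i, j). if j = t then A (\<rho> i) c else ?M i j) =
          mat r r (\<lambda>(i, j). if j < t then ?B (\<rho> i) (\<sigma> j) else A (\<rho> i) ((\<kappa>(t := c)) j))"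
        by (rule eq_matI) auto
      then show ?thesis using Suc.IH[of "\<kappa>(t := c)"] Suc.prems that by auto
    qed
    show ?case
      unfolding eq
      by (subst det_column_linear) (use Suc.prems in \<open>auto intro!: add_mem mult_mem IH d e\<close>)
  qed
  have "minor ?B r \<rho> \<sigma> = det (mat r r (\<lambda>(i, j). if j < r then ?B (\<rho> i) (\<sigma> j) else A (\<rho> i) (f (\<sigma> j))))"
    unfolding minor_def by (rule arg_cong[where f = det]) (auto intro!: eq_matI)
  then show "minor ?B r \<rho> \<sigma> \<in> P" using step[of r "\<lambda>j. f (\<sigma> j)"] by simp
qed

lemma TP_mix_rows:
  assumes "TP A" "\<And>i. d i \<in> P" "\<And>i. e i \<in> P"
    "\<And>i. f i \<le> g i" "\<And>i j. i < j \<Longrightarrow> g i \<le> f j"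
  shows "TP (\<lambda>i j. d i * A (f i) j + e i * A (g i) j)"
  using TP_transpose[OF TP_mix_columns[OF TP_transpose[OF assms(1)] assms(2-5)]] .

lemma TP_scale_columns:
  assumes "TP A" "\<And>j. d j \<in> P"
  shows "TP (\<lambda>i j. d j * A i j)"
  using TP_mix_columns[OF assms, of "\<lambda>_. 0" "\<lambda>j. j" "\<lambda>j. j"] zero_mem by simp

text \<open>If the chosen rows and columns differ, then at the first index where they do, the smaller
  of the two chosen numbers is missing from the other choice, and the minor has a zero row or a
  zero column.\<close>

lemma TP_identity: "TP (\<lambda>i j. if i = j then 1 else 0)" (is "TP ?I")
  unfolding TP_iff
proof (intro allI impI)
  fix r and \<rho> \<sigma> :: "nat \<Rightarrow> nat"
  assume *: "strict_mono_on {..<r} \<rho>" "strict_mono_on {..<r} \<sigma>"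
  have zero: "minor ?I r \<rho> \<sigma> = 0"
    if *: "strict_mono_on {..<r} \<rho>" "strict_mono_on {..<r} \<sigma>"
      and i: "i < r" "\<sigma> i < \<rho> i" and eq: "\<And>j. j < i \<Longrightarrow> \<rho> j = \<sigma> j" for \<rho> \<sigma> :: "nat \<Rightarrow> nat" and i
  proof -
    have "\<rho> j \<noteq> \<sigma> i" if j: "j < r" for j
    proof (cases "j < i")
      case True
      have "\<sigma> j < \<sigma> i" using *(2) True i by (auto simp: strict_mono_on_def)
      then show ?thesis using eq[OF True] by simp
    next
      case False
      have "\<rho> i \<le> \<rho> j" using *(1) False i j by (cases "i = j") (auto simp: strict_mono_on_def intro: less_imp_le)
      then show ?thesis using i by simp
    qed
    then show ?thesis
      unfolding minor_def by (intro det_zero_column[of _ r i]) (use i in auto)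
  qed
  show "minor ?I r \<rho> \<sigma> \<in> P"
  proof (cases "\<forall>i<r. \<rho> i = \<sigma> i")
    case True
    have "\<sigma> i = \<sigma> j \<longleftrightarrow> i = j" if "i < r" "j < r" for i j
      using *(2) that by (metis lessThan_iff linorder_neqE_nat nat_neq_iff strict_mono_on_def)
    then have "mat r r (\<lambda>(i, j). ?I (\<rho> i) (\<sigma> j)) = 1\<^sub>m r"
      using True by (intro eq_matI) auto
    then show ?thesis by (simp add: minor_def one_mem)
  next
    case False
    define i where "i = (LEAST i. i < r \<and> \<rho> i \<noteq> \<sigma> i)"
    have i: "i < r" "\<rho> i \<noteq> \<sigma> i"
      using LeastI_ex[of "\<lambda>i. i < r \<and> \<rho> i \<noteq> \<sigma> i"] False unfolding i_def by auto
    have least: "\<rho> j = \<sigma> j" if "j < i" for j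
      using not_less_Least[of j "\<lambda>i. i < r \<and> \<rho> i \<noteq> \<sigma> i"] that i(1) unfolding i_def[symmetric] by auto
    consider "\<sigma> i < \<rho> i" | "\<rho> i < \<sigma> i" using i(2) by linarith
    then have "minor ?I r \<rho> \<sigma> = 0"
    proof cases
      case 1
      then show ?thesis using zero[OF * i(1)] least by blast
    next
      case 2
      have "minor ?I r \<sigma> \<rho> = 0" using zero[OF *(2,1) i(1) 2] least by metis
      moreover have "minor ?I r \<sigma> \<rho> = minor (\<lambda>i j. ?I j i) r \<sigma> \<rho>"
        by (rule minor_cong) auto
      ultimately show ?thesis using minor_transpose[of ?I r \<sigma> \<rho>] by argo
    qed
    then show ?thesis by (simp add: zero_mem)
  qed
qed

text \<open>An infinite product of bidiagonal factors makes sense when every entry is eventually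
  constant; a minor only sees finitely many entries, so total positivity survives.\<close>

lemma TP_stabilizing_limit:
  assumes TP: "\<And>t. TP (A t)" and lim: "\<And>t i j. i \<le> t \<Longrightarrow> j \<le> t \<Longrightarrow> A t i j = B i j"
  shows "TP B"
  unfolding TP_iff
proof (intro allI impI)
  fix r and \<rho> \<sigma> :: "nat \<Rightarrow> nat"
  assume *: "strict_mono_on {..<r} \<rho>" "strict_mono_on {..<r} \<sigma>"
  define t where "t = (\<Sum>i<r. \<rho> i + \<sigma> i)"
  have "\<rho> i + \<sigma> i \<le> t" if "i < r" for i
    unfolding t_def by (rule member_le_sum) (use that in auto)
  then have "minor (A t) r \<rho> \<sigma> = minor B r \<rho> \<sigma>"
    by (intro minor_cong lim) (meson add_leD1 add_leD2)+
  then show "minor B r \<rho> \<sigma> \<in> P" using TP[of t] * unfolding TP_iff by metis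
qed

text \<open>Left multiplication of \<open>M\<close> by the weighted Pascal matrix with entries
  \<open>(n choose m) * w n * w (n - 1) * \<dots> * w (m + 1)\<close>, that is, by the Pascal matrix conjugated with
  the diagonal matrix of partial products of \<open>w\<close>, written without division because weights may
  vanish. The summation index is the distance \<open>n - m\<close> from the diagonal.\<close>

definition pascal_mult :: "(nat \<Rightarrow> 'a) \<Rightarrow> (nat \<Rightarrow> nat \<Rightarrow> 'a) \<Rightarrow> nat \<Rightarrow> nat \<Rightarrow> 'a" where
  "pascal_mult w M n j = (\<Sum>k\<le>n. of_nat (n choose k) * (\<Prod>l<k. w (n - l)) * M (n - k) j)"

text \<open>The weighted Pascal matrix is an infinite product of bidiagonal matrices: at stage \<open>t\<close> every
  row \<open>i > t\<close> receives \<open>w i\<close> times row \<open>i - 1\<close>, and Pascal's rule raises the binomial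
  coefficients \<open>t choose k\<close> in that row to \<open>Suc t choose k\<close>. Row \<open>i\<close> is final after stage \<open>i\<close>.
  Only weights with positive index occur.\<close>

lemma TP_pascal_mult:
  assumes M: "TP M" and w: "\<And>n. n > 0 \<Longrightarrow> w n \<in> P"
  shows "TP (pascal_mult w M)"
proof -
  define X where "X i j k = (\<Prod>l<k. w (i - l)) * M (i - k) j" for i j k
  define A where "A t i j = (\<Sum>k\<le>min t i. of_nat (min t i choose k) * X i j k)" for t i j
  have X_Suc: "X i j (Suc k) = w i * X (i - 1) j k" for i j k
    unfolding X_def by (subst prod.lessThan_Suc_shift) (simp add: mult.assoc)
  have TP: "TP (A t)" for t
  proof (induction t)
    case 0
    have "A 0 = M" by (simp add: A_def X_def fun_eq_iff)
    then show ?case using M by simp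
  next
    case (Suc t)
    have "A (Suc t) i j = (if t < i then w i else 0) * A t (i - 1) j + 1 * A t i j" for i j
    proof (cases "t < i")
      case True
      have "A (Suc t) i j = (\<Sum>k\<le>Suc t. of_nat (Suc t choose k) * X i j k)"
        using True by (simp add: A_def min_def)
      also have "\<dots> = X i j 0 + (\<Sum>k\<le>t. of_nat (t choose Suc k) * X i j (Suc k))
          + (\<Sum>k\<le>t. of_nat (t choose k) * X i j (Suc k))"
        by (subst sum.atMost_Suc_shift) (simp add: sum.distrib algebra_simps)
      also have "X i j 0 + (\<Sum>k\<le>t. of_nat (t choose Suc k) * X i j (Suc k)) =
          (\<Sum>k\<le>Suc t. of_nat (t choose k) * X i j k)"
        by (subst sum.atMost_Suc_shift) simp
      also have "\<dots> = A t i j" using True by (simp add: A_def min_def binomial_eq_0)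
      also have "(\<Sum>k\<le>t. of_nat (t choose k) * X i j (Suc k)) = w i * A t (i - 1) j"
        using True by (simp add: A_def min_def X_Suc sum_distrib_left algebra_simps)
      finally show ?thesis using True by (simp add: add.commute)
    next
      case False
      then show ?thesis by (simp add: A_def min_def not_less)
    qed
    then have "A (Suc t) = (\<lambda>i j. (if t < i then w i else 0) * A t (i - 1) j + 1 * A t i j)"
      by (simp add: fun_eq_iff)
    moreover have "TP (\<lambda>i j. (if t < i then w i else 0) * A t (i - 1) j + 1 * A t i j)"
      by (rule TP_mix_rows[OF Suc.IH]) (use w zero_mem one_mem in auto)
    ultimately show ?case by simp
  qed
  show ?thesis
  proof (rule TP_stabilizing_limit[of A])
    show "TP (A t)" for t by (rule TP)
    show "A t i j = pascal_mult w M i j" if "i \<le> t" for t i j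
      using that by (simp add: A_def X_def pascal_mult_def min_def mult.assoc)
  qed
qed

end

interpretation real_cone: nonneg_cone "{x :: real. 0 \<le> x}"
  by unfold_locales auto

interpretation poly_cone: nonneg_cone "{p. nonneg_coeffs p}"
proof
  show "x * y \<in> {p. nonneg_coeffs p}" if "x \<in> {p. nonneg_coeffs p}" "y \<in> {p. nonneg_coeffs p}" for x y
    using that by (auto simp: nonneg_coeffs_def coeff_mult intro!: sum_nonneg)
qed (auto simp: nonneg_coeffs_def coeff_1)

section \<open>The Laguerre triangle\<close>

text \<open>The Laguerre triangle is the weighted Pascal matrix with weights \<open>n + \<alpha>\<close>. For
  \<open>n \<ge> 1\<close> these are nonnegative as soon as \<open>\<alpha> \<ge> -1\<close>.\<close>

lemma laguerre_coeff_eq_prod: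
  assumes "k \<le> n"
  shows "laguerre_coeff \<alpha> n k = real (n choose k) * (\<Prod>l<n - k. real (n - l) + \<alpha>)"
proof -
  have "laguerre_coeff \<alpha> n k = ((real n + \<alpha>) gchoose (n - k)) * (fact n / fact k)"
    using assms by (simp add: laguerre_coeff_def int_gbinomial_def nat_diff_distrib)
  also have "\<dots> = (\<Prod>l<n - k. real n + \<alpha> - real l) * (fact n / (fact k * fact (n - k)))"
    by (simp add: gbinomial_prod_rev atLeast0LessThan)
  also have "(\<Prod>l<n - k. real n + \<alpha> - real l) = (\<Prod>l<n - k. real (n - l) + \<alpha>)"
    by (rule prod.cong) auto
  finally show ?thesis using assms by (simp add: binomial_fact mult.commute)
qed

lemma laguerre_coeff_eq_0: "n < k \<Longrightarrow> laguerre_coeff \<alpha> n k = 0"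
  by (simp add: laguerre_coeff_def int_gbinomial_def)

lemma laguerre_coeff_eq_pochhammer:
  "laguerre_coeff \<alpha> n k = real (n choose k) * pochhammer (real k + \<alpha> + 1) (n - k)"
proof (cases "k \<le> n")
  case True
  have "(\<Prod>l<n - k. real (n - l) + \<alpha>) = (\<Prod>l<n - k. real (n - (n - k - Suc l)) + \<alpha>)"
    by (rule prod.nat_diff_reindex[symmetric])
  also have "\<dots> = pochhammer (real k + \<alpha> + 1) (n - k)"
    unfolding pochhammer_prod atLeast0LessThan
    by (rule prod.cong) (use True in \<open>auto simp: of_nat_diff\<close>)
  finally show ?thesis using True by (simp add: laguerre_coeff_eq_prod)
qed (simp add: laguerre_coeff_eq_0)

text \<open>Coefficient form of \<open>signless_laguerre_Suc\<close>. With \<open>X = pochhammer (k + \<alpha> + 1) (n - k)\<close> all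
  terms are multiples of \<open>X\<close>, and the identity becomes one about binomial coefficients.\<close>

lemma laguerre_coeff_Suc:
  "laguerre_coeff \<alpha> (Suc n) k =
     (if k = 0 then 0 else laguerre_coeff \<alpha> n (k - 1)) +
     (2 * real k + \<alpha> + 1) * laguerre_coeff \<alpha> n k +
     (real k + 1) * (real k + \<alpha> + 1) * laguerre_coeff \<alpha> n (Suc k)"
proof -
  consider "k > Suc n" | "k = Suc n" | "k \<le> n" by linarith
  then show ?thesis
  proof cases
    case 3
    define X where "X = pochhammer (real k + \<alpha> + 1) (n - k)"
    have up: "(real k + 1) * (real k + \<alpha> + 1) * laguerre_coeff \<alpha> n (Suc k) = real (n - k) * real (n choose k) * X"
    proof (cases "k = n")
      case False
      then have "n - k = Suc (n - Suc k)" using 3 by simp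
      then have "X = (real k + \<alpha> + 1) * pochhammer (real (Suc k) + \<alpha> + 1) (n - Suc k)"
        unfolding X_def by (simp add: pochhammer_rec add_ac)
      moreover have "(real k + 1) * real (n choose Suc k) = real (n - k) * real (n choose k)"
      proof -
        have "Suc k * (n choose Suc k) = (n - k) * (n choose k)"
          by (metis binomial_absorb_comp binomial_absorption)
        then show ?thesis by (metis of_nat_Suc of_nat_mult add.commute)
      qed
      ultimately have "real (n - k) * real (n choose k) * X =
          ((real k + 1) * real (n choose Suc k)) * ((real k + \<alpha> + 1) * pochhammer (real (Suc k) + \<alpha> + 1) (n - Suc k))"
        by simp
      then show ?thesis by (simp only: laguerre_coeff_eq_pochhammer mult_ac)
    qed (simp add: laguerre_coeff_eq_0)
    have mid: "laguerre_coeff \<alpha> n k = real (n choose k) * X"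
      by (simp add: laguerre_coeff_eq_pochhammer X_def)
    have new: "laguerre_coeff \<alpha> (Suc n) k = real (Suc n choose k) * X * (real n + \<alpha> + 1)"
      using 3 by (simp add: laguerre_coeff_eq_pochhammer X_def Suc_diff_le pochhammer_Suc of_nat_diff)
    show ?thesis
    proof (cases k)
      case 0
      then show ?thesis unfolding new mid up using 3 by (simp add: of_nat_diff algebra_simps)
    next
      case (Suc m)
      have "n - m = Suc (n - k)" using Suc 3 by simp
      then have down: "laguerre_coeff \<alpha> n m = real (n choose m) * (real k + \<alpha>) * X"
        by (simp add: laguerre_coeff_eq_pochhammer X_def pochhammer_rec Suc add_ac)
      have "Suc m * (n choose Suc m) = (n - m) * (n choose m)"
        by (metis binomial_absorb_comp binomial_absorption)
      then have "real k * real (n choose k) = (real n - real m) * real (n choose m)"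
        using 3 Suc by (metis Suc_leD of_nat_diff of_nat_mult)
      then have *: "real m * real (n choose m) = real n * real (n choose m) - real k * real (n choose k)"
        by (simp add: algebra_simps)
      have "real (Suc n choose k) = real (n choose k) + real (n choose m)"
        by (simp add: Suc)
      then show ?thesis
        unfolding new mid up using 3 Suc arg_cong[OF *, of "\<lambda>x. x * X"] down
        by (simp add: of_nat_diff algebra_simps)
    qed
  qed (simp_all add: laguerre_coeff_eq_0 laguerre_coeff_eq_pochhammer binomial_eq_0)
qed

section \<open>Hankel minors of the Laguerre polynomials\<close>

definition plus_pderiv :: "real poly \<Rightarrow> real poly" where
  "plus_pderiv p = p + pderiv p"

lemma coeff_plus_pderiv: "coeff (plus_pderiv p) k = coeff p k + (real k + 1) * coeff p (Suc k)"
  by (simp add: plus_pderiv_def coeff_pderiv)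

lemma plus_pderiv_add: "plus_pderiv (p + r) = plus_pderiv p + plus_pderiv r"
  and plus_pderiv_smult: "plus_pderiv (smult c p) = smult c (plus_pderiv p)"
  and plus_pderiv_pCons: "plus_pderiv (pCons 0 p) = pCons 0 (plus_pderiv p) + p"
  by (simp_all add: plus_pderiv_def pderiv_add pderiv_smult pderiv_pCons smult_add_right)

lemma plus_pderiv_power_linear:
  "(plus_pderiv ^^ s) (p + smult c r) = (plus_pderiv ^^ s) p + smult c ((plus_pderiv ^^ s) r)"
  by (induction s) (simp_all add: plus_pderiv_add plus_pderiv_smult)

lemma plus_pderiv_power_sum:
  "(plus_pderiv ^^ s) (\<Sum>k\<le>(n::nat). smult (c k) (p k)) = (\<Sum>k\<le>n. smult (c k) ((plus_pderiv ^^ s) (p k)))"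
proof (induction n)
  case 0
  show ?case by (induction s) (simp_all add: plus_pderiv_smult)
next
  case (Suc n)
  then show ?case by (simp add: plus_pderiv_power_linear)
qed

text \<open>The commutation rule between \<open>(1 + D)\<^sup>s\<close> and multiplication by \<open>q\<close>, which \<open>pCons 0\<close>
  performs.\<close>

lemma plus_pderiv_power_pCons:
  "(plus_pderiv ^^ s) (pCons 0 p) = pCons 0 ((plus_pderiv ^^ s) p) + smult (real s) ((plus_pderiv ^^ (s - 1)) p)"
proof (induction s)
  case (Suc s)
  have "(plus_pderiv ^^ Suc s) (pCons 0 p) =
      pCons 0 (plus_pderiv ((plus_pderiv ^^ s) p)) + (plus_pderiv ^^ s) p
      + smult (real s) ((plus_pderiv ^^ Suc (s - 1)) p)"
    by (simp add: Suc plus_pderiv_add plus_pderiv_smult plus_pderiv_pCons)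
  also have "smult (real s) ((plus_pderiv ^^ Suc (s - 1)) p) = smult (real s) ((plus_pderiv ^^ s) p)"
    by (cases s) simp_all
  finally show ?case by (simp add: smult_add_left add_ac)
qed simp

lemma signless_laguerre_Suc:
  "signless_laguerre \<alpha> (Suc n) =
     pCons 0 (plus_pderiv (plus_pderiv (signless_laguerre \<alpha> n)))
     + smult (\<alpha> + 1) (plus_pderiv (signless_laguerre \<alpha> n))"
proof (rule poly_eqI)
  fix k
  show "coeff (signless_laguerre \<alpha> (Suc n)) k = coeff (pCons 0 (plus_pderiv (plus_pderiv (signless_laguerre \<alpha> n)))
     + smult (\<alpha> + 1) (plus_pderiv (signless_laguerre \<alpha> n))) k"
    by (cases k) (simp_all add: coeff_signless_laguerre laguerre_coeff_Suc coeff_plus_pderiv algebra_simps)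
qed

text \<open>The key recurrence. It passes from the sequence \<open>(1 + D)\<^sup>s L\<^sub>n\<close> in \<open>s\<close> to the one for
  \<open>n + 1\<close> by combining two neighbouring terms with nonnegative coefficients: a bidiagonal
  operation.\<close>

lemma plus_pderiv_power_signless_laguerre_Suc:
  "(plus_pderiv ^^ s) (signless_laguerre \<alpha> (Suc n)) =
     [:real s + \<alpha> + 1:] * (plus_pderiv ^^ (s + 1)) (signless_laguerre \<alpha> n)
     + [:0, 1:] * (plus_pderiv ^^ (s + 2)) (signless_laguerre \<alpha> n)"
proof -
  let ?L = "signless_laguerre \<alpha> n"
  have "(plus_pderiv ^^ s) (signless_laguerre \<alpha> (Suc n)) =
     pCons 0 ((plus_pderiv ^^ s) (plus_pderiv (plus_pderiv ?L)))
     + smult (real s) ((plus_pderiv ^^ (s - 1)) (plus_pderiv (plus_pderiv ?L)))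
     + smult (\<alpha> + 1) ((plus_pderiv ^^ s) (plus_pderiv ?L))"
    by (simp only: signless_laguerre_Suc plus_pderiv_power_linear plus_pderiv_power_pCons)
  also have "smult (real s) ((plus_pderiv ^^ (s - 1)) (plus_pderiv (plus_pderiv ?L))) = smult (real s) ((plus_pderiv ^^ (s + 1)) ?L)"
    by (cases s) (simp_all add: funpow_swap1)
  finally show ?thesis
    by (simp add: funpow_swap1 smult_add_left)
qed

lemma higher_pderiv_monom_1:
  "(pderiv ^^ k) (monom 1 m :: real poly) = monom (fact k * real (m choose k)) (m - k)"
proof (induction k)
  case (Suc k)
  have "real (m - k) * real (m choose k) = (1 + real k) * real (m choose Suc k)"
    by (metis binomial_absorb_comp binomial_absorption of_nat_Suc of_nat_mult)
  then show ?case by (simp add: Suc pderiv_monom)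
qed simp

text \<open>The entry \<open>D\<^sup>k q\<^sup>m\<close> equals \<open>k!\<close> times \<open>(m choose k) * q ^ (m - k)\<close>: a Pascal matrix with
  constant weight \<open>q\<close>, followed by a scaling of the columns.\<close>

lemma TP_higher_pderiv_monom: "poly_cone.TP (\<lambda>m k. (pderiv ^^ k) (monom 1 m))"
proof -
  have "poly_cone.pascal_mult (\<lambda>_. [:0, 1:]) (\<lambda>i j. if i = j then 1 else 0) m k =
      of_nat (m choose k) * [:0, 1:] ^ (m - k)" for m k
  proof -
    have "poly_cone.pascal_mult (\<lambda>_. [:0, 1:]) (\<lambda>i j. if i = j then 1 else 0) m k =
        (\<Sum>l\<le>m. if m - l = k then of_nat (m choose l) * [:0, 1:] ^ l else 0)"
      by (simp add: poly_cone.pascal_mult_def if_distrib cong: if_cong)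
    also have "\<dots> = (\<Sum>l\<le>m. if l = m - k \<and> k \<le> m then of_nat (m choose l) * [:0, 1:] ^ l else 0)"
      by (rule sum.cong) auto
    also have "\<dots> = of_nat (m choose k) * [:0, 1:] ^ (m - k)"
      by (cases "k \<le> m") (simp_all add: binomial_symmetric[of k m] binomial_eq_0)
    finally show ?thesis .
  qed
  moreover have "(pderiv ^^ k) (monom 1 m :: real poly) = [:fact k:] * (of_nat (m choose k) * [:0, 1:] ^ (m - k))"
    for m k :: nat
    unfolding higher_pderiv_monom_1 by (simp add: of_nat_poly monom_altdef mult.commute)
  moreover have "poly_cone.TP (\<lambda>m k. [:fact k:] *
      poly_cone.pascal_mult (\<lambda>_. [:0, 1:]) (\<lambda>i j. if i = j then 1 else 0) m k)"
    by (intro poly_cone.TP_scale_columns poly_cone.TP_pascal_mult poly_cone.TP_identity)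
       (auto simp: nonneg_coeffs_def coeff_pCons split: nat.split)
  ultimately show ?thesis by simp
qed

text \<open>Expanding \<open>(1 + D)\<^sup>s\<close> by the binomial theorem multiplies the transpose of the previous
  matrix by the ordinary Pascal matrix.\<close>

lemma TP_plus_pderiv_monom: "poly_cone.TP (\<lambda>m s. (plus_pderiv ^^ s) (monom 1 m))"
proof -
  have "(plus_pderiv ^^ s) p = (\<Sum>k\<le>s. of_nat (s choose k) * (pderiv ^^ (s - k)) p)" for s p
  proof (induction s)
    case (Suc s)
    have [simp]: "pderiv (\<Sum>k\<le>n. f k) = (\<Sum>k\<le>n. pderiv (f k))" for f :: "nat \<Rightarrow> real poly" and n
      by (induction n) (simp_all add: pderiv_add)
    have "(\<Sum>k\<le>Suc s. of_nat (Suc s choose k) * (pderiv ^^ (Suc s - k)) p) =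
       (pderiv ^^ Suc s) p + (\<Sum>k\<le>s. of_nat (s choose Suc k) * (pderiv ^^ (s - k)) p)
        + (\<Sum>k\<le>s. of_nat (s choose k) * (pderiv ^^ (s - k)) p)"
      by (subst sum.atMost_Suc_shift) (simp add: sum.distrib algebra_simps)
    also have "(pderiv ^^ Suc s) p + (\<Sum>k\<le>s. of_nat (s choose Suc k) * (pderiv ^^ (s - k)) p) =
        (\<Sum>k\<le>Suc s. of_nat (s choose k) * (pderiv ^^ (Suc s - k)) p)"
      by (subst sum.atMost_Suc_shift) simp
    also have "\<dots> = (\<Sum>k\<le>s. of_nat (s choose k) * (pderiv ^^ (Suc s - k)) p)"
      by (simp add: binomial_eq_0)
    also have "\<dots> = pderiv ((plus_pderiv ^^ s) p)"
      by (simp add: Suc of_nat_poly pderiv_smult Suc_diff_le)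
    also have "(\<Sum>k\<le>s. of_nat (s choose k) * (pderiv ^^ (s - k)) p) = (plus_pderiv ^^ s) p"
      by (simp add: Suc)
    finally show ?case using plus_pderiv_def[of "(plus_pderiv ^^ s) p"] by (simp add: add.commute)
  qed simp
  then have "(plus_pderiv ^^ s) (monom 1 m) =
      poly_cone.pascal_mult (\<lambda>_. 1) (\<lambda>k m. (pderiv ^^ k) (monom 1 m)) s m" for s m
    by (simp add: poly_cone.pascal_mult_def)
  moreover have "poly_cone.TP (\<lambda>m s. poly_cone.pascal_mult (\<lambda>_. 1) (\<lambda>k m. (pderiv ^^ k) (monom 1 m)) s m)"
    by (rule poly_cone.TP_transpose, rule poly_cone.TP_pascal_mult)
       (use poly_cone.TP_transpose[OF TP_higher_pderiv_monom] poly_cone.one_mem in auto)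
  ultimately show ?thesis by simp
qed

context
  fixes \<alpha> :: real
  assumes \<alpha>: "-1 \<le> \<alpha>"
begin

text \<open>By linearity, the row of \<open>L\<^sub>n\<close> is the combination of the rows of \<open>q\<^sup>m\<close> with the
  coefficients of \<open>L\<^sub>n\<close>; these form a weighted Pascal matrix.\<close>

lemma TP_plus_pderiv_signless_laguerre: "poly_cone.TP (\<lambda>n s. (plus_pderiv ^^ s) (signless_laguerre \<alpha> n))"
proof -
  have "(plus_pderiv ^^ s) (signless_laguerre \<alpha> n) =
      poly_cone.pascal_mult (\<lambda>m. [:real m + \<alpha>:]) (\<lambda>m s. (plus_pderiv ^^ s) (monom 1 m)) n s" for n s
  proof -
    have const: "(\<Prod>l<k. [:c l:]) = [:\<Prod>l<k. c l:]" for k and c :: "nat \<Rightarrow> real"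
      by (induction k) simp_all
    have "signless_laguerre \<alpha> n = (\<Sum>k\<le>n. smult (laguerre_coeff \<alpha> n k) (monom 1 k))"
      by (simp add: signless_laguerre_def smult_monom)
    also have "\<dots> = (\<Sum>k\<le>n. smult (laguerre_coeff \<alpha> n (n - k)) (monom 1 (n - k)))"
      by (rule sum.reindex_bij_witness[of _ "\<lambda>k. n - k" "\<lambda>k. n - k"]) auto
    finally have "(plus_pderiv ^^ s) (signless_laguerre \<alpha> n) =
        (\<Sum>k\<le>n. smult (laguerre_coeff \<alpha> n (n - k)) ((plus_pderiv ^^ s) (monom 1 (n - k))))"
      by (simp add: plus_pderiv_power_sum)
    also have "\<dots> = (\<Sum>k\<le>n. of_nat (n choose k) * (\<Prod>l<k. [:real (n - l) + \<alpha>:]) *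
        (plus_pderiv ^^ s) (monom 1 (n - k)))"
      by (rule sum.cong)
         (simp_all add: laguerre_coeff_eq_prod const of_nat_poly binomial_symmetric[symmetric] mult.commute)
    finally show ?thesis by (simp add: poly_cone.pascal_mult_def)
  qed
  moreover have "poly_cone.TP (poly_cone.pascal_mult (\<lambda>m. [:real m + \<alpha>:]) (\<lambda>m s. (plus_pderiv ^^ s) (monom 1 m)))"
    by (rule poly_cone.TP_pascal_mult[OF TP_plus_pderiv_monom])
       (use \<alpha> in \<open>auto simp: nonneg_coeffs_def coeff_pCons split: nat.split\<close>)
  ultimately show ?thesis by (simp add: poly_cone.TP_def)
qed

lemma totally_positive_laguerre_coeff: "totally_positive (laguerre_coeff \<alpha>)"
proof -
  have "real_cone.pascal_mult (\<lambda>m. real m + \<alpha>) (\<lambda>i j. if i = j then 1 else 0) n k = laguerre_coeff \<alpha> n k" for n k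
  proof -
    have "real_cone.pascal_mult (\<lambda>m. real m + \<alpha>) (\<lambda>i j. if i = j then 1 else 0) n k =
        (\<Sum>l\<le>n. if n - l = k then of_nat (n choose l) * (\<Prod>i<l. real (n - i) + \<alpha>) else 0)"
      by (simp add: real_cone.pascal_mult_def if_distrib cong: if_cong)
    also have "\<dots> = (\<Sum>l\<le>n. if l = n - k \<and> k \<le> n then of_nat (n choose l) * (\<Prod>i<l. real (n - i) + \<alpha>) else 0)"
      by (rule sum.cong) auto
    also have "\<dots> = laguerre_coeff \<alpha> n k"
      by (cases "k \<le> n") (simp_all add: binomial_symmetric[of k n] laguerre_coeff_eq_prod laguerre_coeff_eq_0)
    finally show ?thesis .
  qed
  then have "real_cone.pascal_mult (\<lambda>m. real m + \<alpha>) (\<lambda>i j. if i = j then 1 else 0) = laguerre_coeff \<alpha>"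
    by (simp add: fun_eq_iff)
  moreover have "real_cone.TP (real_cone.pascal_mult (\<lambda>m. real m + \<alpha>) (\<lambda>i j. if i = j then 1 else 0))"
    by (rule real_cone.TP_pascal_mult[OF real_cone.TP_identity]) (use \<alpha> in auto)
  ultimately show ?thesis
    by (auto simp: real_cone.TP_def totally_positive_def)
qed

text \<open>The matrices \<open>M t\<close> interpolate between \<open>(1 + D)\<^sup>j L\<^sub>i\<close> at \<open>t = 0\<close> and the Hankel matrix
  \<open>L\<^bsub>i + j\<^esub>\<close> in the limit. The columns up to \<open>t\<close> are already those of the Hankel matrix,
  the later ones hold \<open>(1 + D)\<^bsup>j - t\<^esup> L\<^bsub>i + t\<^esub>\<close>. By the key recurrence, the step from \<open>M t\<close>
  to \<open>M (Suc t)\<close> is a bidiagonal operation on the columns after \<open>t\<close>.\<close>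

lemma q_Stieltjes_moment_signless_laguerre: "q_Stieltjes_moment (signless_laguerre \<alpha>)"
proof -
  define M where "M t i j = (plus_pderiv ^^ (j - t)) (signless_laguerre \<alpha> (i + min t j))" for t i j :: nat
  have "poly_cone.TP (M t)" for t
  proof (induction t)
    case 0
    then show ?case using TP_plus_pderiv_signless_laguerre by (simp add: M_def [abs_def])
  next
    case (Suc t)
    have "M (Suc t) i j = (if j \<le> t then 1 else [:real (j - Suc t) + \<alpha> + 1:]) * M t i j
        + (if j \<le> t then 0 else [:0, 1:]) * M t i (Suc j)" for i j
    proof (cases "j \<le> t")
      case False
      then obtain s where "j = Suc t + s" by (metis not_less_eq_eq le_Suc_ex)
      then show ?thesis
        using plus_pderiv_power_signless_laguerre_Suc[of s \<alpha> "i + t"] by (simp add: M_def)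
    qed (simp add: M_def min_def)
    then have "M (Suc t) = (\<lambda>i j. (if j \<le> t then 1 else [:real (j - Suc t) + \<alpha> + 1:]) * M t i j
        + (if j \<le> t then 0 else [:0, 1:]) * M t i (Suc j))"
      by (simp add: fun_eq_iff)
    moreover have "poly_cone.TP (\<lambda>i j. (if j \<le> t then 1 else [:real (j - Suc t) + \<alpha> + 1:]) * M t i j
        + (if j \<le> t then 0 else [:0, 1:]) * M t i (Suc j))"
      by (rule poly_cone.TP_mix_columns[OF Suc.IH])
         (use \<alpha> in \<open>auto simp: nonneg_coeffs_def coeff_pCons split: nat.split\<close>)
    ultimately show ?case by simp
  qed
  then have "poly_cone.TP (\<lambda>i j. signless_laguerre \<alpha> (i + j))"
    by (rule poly_cone.TP_stabilizing_limit[of M]) (simp add: M_def min_def)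
  then show ?thesis by (auto simp: poly_cone.TP_def q_Stieltjes_moment_def)
qed

end

section \<open>From Hankel minors to log-convexity\<close>

lemma det_first_column:
  fixes f :: "nat \<Rightarrow> nat \<Rightarrow> 'a::comm_ring_1"
  shows "det (mat (Suc n) (Suc n) (\<lambda>(i, j). f i j)) =
    (\<Sum>i<Suc n. (-1) ^ i * f i 0 * det (mat n n (\<lambda>(r, c). f (if r < i then r else Suc r) (Suc c))))"
proof -
  let ?A = "mat (Suc n) (Suc n) (\<lambda>(i, j). f i j)"
  have "det ?A = (\<Sum>i<Suc n. ?A $$ (i, 0) * cofactor ?A i 0)"
    by (rule laplace_expansion_column) auto
  also have "\<dots> = (\<Sum>i<Suc n. (-1) ^ i * f i 0 * det (mat n n (\<lambda>(r, c). f (if r < i then r else Suc r) (Suc c))))"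
  proof (rule sum.cong[OF refl])
    fix i assume i: "i \<in> {..<Suc n}"
    have "mat_delete ?A i 0 = mat n n (\<lambda>(r, c). f (if r < i then r else Suc r) (Suc c))"
      unfolding mat_delete_def by (rule eq_matI) (use i in auto)
    then show "?A $$ (i, 0) * cofactor ?A i 0 =
        (-1) ^ i * f i 0 * det (mat n n (\<lambda>(r, c). f (if r < i then r else Suc r) (Suc c)))"
      using i by (simp add: cofactor_def)
  qed
  finally show ?thesis .
qed

lemma nonneg_coeffs_Hankel_det:
  assumes "q_Stieltjes_moment a"
  shows "nonneg_coeffs (det (mat r r (\<lambda>(i, j). a (m + i + j))))"
proof -
  have "strict_mono_on {..<r} (\<lambda>i. m + i)" "strict_mono_on {..<r} (\<lambda>i :: nat. i)"
    by (auto simp: strict_mono_on_def)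
  then have "det (mat r r (\<lambda>(i, j). a ((m + i) + j))) \<in> minors (\<lambda>i j. a (i + j))"
    unfolding minors_def by (intro CollectI exI[of _ r] exI[of _ "\<lambda>i. m + i"] exI[of _ "\<lambda>i. i"]) auto
  then show ?thesis using assms unfolding q_Stieltjes_moment_def by simp
qed

text \<open>Write \<open>D r m\<close> for the Hankel determinant of size \<open>r\<close> that starts with \<open>a m\<close>. The first
  iterate is \<open>D 2\<close>. Dodgson condensation, the determinant of a matrix times that of its interior
  expressed by the four minors obtained on deleting an outer row and an outer column, turns
  second differences of this kind into products: for size \<open>3\<close> it shows that the second
  iterate is \<open>a\<close> times \<open>D 3\<close>, and for size \<open>4\<close> it splits the third iterate into products of
  Hankel determinants.\<close>

lemma three_q_log_convex_if_q_Stieltjes_moment: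
  assumes "q_Stieltjes_moment a"
  shows "three_q_log_convex a"
proof -
  define D where "D r m = det (mat r r (\<lambda>(i, j). a (m + i + j)))" for r m
  have nonneg_D: "nonneg_coeffs (D r m)" for r m
    unfolding D_def by (rule nonneg_coeffs_Hankel_det[OF assms])
  have mult: "nonneg_coeffs (x * y)" if "nonneg_coeffs x" "nonneg_coeffs y" for x y
    using poly_cone.mult_mem that by simp
  have add: "nonneg_coeffs (x + y)" if "nonneg_coeffs x" "nonneg_coeffs y" for x y
    using poly_cone.add_mem that by simp
  note expand = D_def det_first_column det_dim_zero numeral_eq_Suc lessThan_Suc sum.insert
  have D1: "D 1 m = a m" for m
    by (simp add: expand)
  have D2: "D 2 m = a m * a (m + 2) - (a (m + 1))\<^sup>2" for m
    by (simp add: expand power2_eq_square)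
  have D3: "D 3 m = a m * a (m + 2) * a (m + 4) + 2 * a (m + 1) * a (m + 2) * a (m + 3)
      - a m * (a (m + 3))\<^sup>2 - (a (m + 2)) ^ 3 - (a (m + 1))\<^sup>2 * a (m + 4)" for m
    by (simp add: expand algebra_simps)
  have L1: "log_convexity_op a (m + 1) = D 2 m" for m
    by (simp add: log_convexity_op_def D2)
  \<comment> \<open>condensation of the Hankel matrix of size 3, whose interior is a single entry\<close>
  have L2: "log_convexity_op (log_convexity_op a) (m + 2) = D 1 (m + 2) * D 3 m" for m
  proof -
    have "log_convexity_op (log_convexity_op a) (m + 2) = D 2 m * D 2 (m + 2) - (D 2 (m + 1))\<^sup>2"
      using L1[of m] L1[of "m + 1"] L1[of "m + 2"] by (simp add: log_convexity_op_def[of "log_convexity_op a"])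
    also have "\<dots> = D 1 (m + 2) * D 3 m"
      unfolding D1 D2 D3 by (simp add: eval_nat_numeral algebra_simps)
    finally show ?thesis .
  qed
  \<comment> \<open>condensation of the Hankel matrix of size 4, whose interior has size 2\<close>
  have desnanot: "D 3 m * D 3 (m + 2) - (D 3 (m + 1))\<^sup>2 = D 2 (m + 2) * D 4 m" for m
  proof -
    \<comment> \<open>cofactor expansion; the outer two cofactors are Hankel determinants again\<close>
    have D4: "D 4 m = a m * D 3 (m + 2)
       - a (m + 1) * (a (m + 1) * (a (m + 4) * a (m + 6) - a (m + 5) ^ 2)
           - a (m + 3) * (a (m + 2) * a (m + 6) - a (m + 3) * a (m + 5))
           + a (m + 4) * (a (m + 2) * a (m + 5) - a (m + 3) * a (m + 4)))
       + a (m + 2) * (a (m + 1) * (a (m + 3) * a (m + 6) - a (m + 4) * a (m + 5))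
           - a (m + 2) * (a (m + 2) * a (m + 6) - a (m + 3) * a (m + 5))
           + a (m + 4) * (a (m + 2) * a (m + 4) - a (m + 3) ^ 2))
       - a (m + 3) * D 3 (m + 1)"
      unfolding D3 by (simp add: expand algebra_simps)
    show ?thesis
      unfolding D4 D2 D3 by (simp add: eval_nat_numeral algebra_simps)
  qed
  have L3: "log_convexity_op (log_convexity_op (log_convexity_op a)) (m + 3) =
      D 2 (m + 2) * (D 3 m * D 3 (m + 2) + D 1 (m + 3) * D 1 (m + 3) * D 4 m)" for m
  proof -
    define b where "b = log_convexity_op (log_convexity_op a)"
    have idx: "m + 3 - 1 = m + 2" "m + 3 + 1 = m + 4" "m + 1 + 2 = m + 3" "m + 2 + 2 = m + 4" by simp_all
    have "log_convexity_op b (m + 3) = b (m + 2) * b (m + 4) - (b (m + 3))\<^sup>2"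
      by (simp only: log_convexity_op_def idx)
    also have "\<dots> = (D 1 (m + 2) * D 3 m) * (D 1 (m + 4) * D 3 (m + 2)) - (D 1 (m + 3) * D 3 (m + 1))\<^sup>2"
      using L2[of m] L2[of "m + 1"] L2[of "m + 2"] unfolding idx b_def[symmetric] by (simp only:)
    also have "\<dots> = (D 1 (m + 2) * D 1 (m + 4) - (D 1 (m + 3))\<^sup>2) * (D 3 m * D 3 (m + 2))
        + (D 1 (m + 3))\<^sup>2 * (D 3 m * D 3 (m + 2) - (D 3 (m + 1))\<^sup>2)"
      by (simp only: power2_eq_square algebra_simps)
    also have "D 1 (m + 2) * D 1 (m + 4) - (D 1 (m + 3))\<^sup>2 = D 2 (m + 2)"
      unfolding D1 D2 by (simp add: eval_nat_numeral)
    also have "D 3 m * D 3 (m + 2) - (D 3 (m + 1))\<^sup>2 = D 2 (m + 2) * D 4 m"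
      by (rule desnanot)
    finally show ?thesis unfolding b_def by (simp only: power2_eq_square distrib_left mult_ac)
  qed
  have "nonneg_coeffs ((log_convexity_op ^^ k) a i)" if kr: "k \<in> {1..3}" and ik: "i \<ge> k" for k i :: nat
  proof -
    obtain m where m: "i = m + k" using ik by (metis le_add_diff_inverse2)
    have "k = 1 \<or> k = 2 \<or> k = 3" using kr by auto
    then show ?thesis
    proof (elim disjE)
      assume k: "k = 1"
      have "(log_convexity_op ^^ 1) a = log_convexity_op a"
        by simp
      then show ?thesis unfolding m k by (simp only: L1 nonneg_D)
    next
      assume k: "k = 2"
      have "(log_convexity_op ^^ 2) a = log_convexity_op (log_convexity_op a)"
        by (simp add: numeral_2_eq_2)
      then show ?thesis unfolding m k by (simp only: L2 mult nonneg_D)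
    next
      assume k: "k = 3"
      have "(log_convexity_op ^^ 3) a = log_convexity_op (log_convexity_op (log_convexity_op a))"
        by (simp add: numeral_3_eq_3)
      then show ?thesis unfolding m k by (simp only: L3 mult add nonneg_D)
    qed
  qed
  then show ?thesis unfolding three_q_log_convex_def by blast
qed

section \<open>Reversed polynomials\<close>

lemma det_mat_permutes:
  fixes f :: "nat \<Rightarrow> nat \<Rightarrow> 'a::comm_ring_1"
  shows "det (mat r r (\<lambda>(i, j). f i j)) = (\<Sum>p | p permutes {0..<r}. signof p * (\<Prod>i=0..<r. f i (p i)))"
proof -
  have "p i < r" if "p permutes {0..<r}" "i < r" for p i
    using permutes_in_image[OF that(1), of i] that(2) by simp
  then show ?thesis
    by (subst det_def'[of _ r]) (auto intro!: sum.cong prod.cong)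
qed

lemma det_scale_rows_columns:
  fixes f :: "nat \<Rightarrow> nat \<Rightarrow> 'a::comm_ring_1"
  shows "det (mat r r (\<lambda>(i, j). u i * v j * f i j)) =
    prod u {0..<r} * prod v {0..<r} * det (mat r r (\<lambda>(i, j). f i j))"
proof -
  have "(\<Prod>i=0..<r. u i * v (p i) * f i (p i)) = prod u {0..<r} * prod v {0..<r} * (\<Prod>i=0..<r. f i (p i))"
    if p: "p permutes {0..<r}" for p
    using prod.permute[OF p, of v] by (simp add: prod.distrib)
  then show ?thesis unfolding det_mat_permutes by (simp add: sum_distrib_left mult_ac)
qed

lemma poly_det:
  fixes f :: "nat \<Rightarrow> nat \<Rightarrow> 'a::comm_ring_1 poly"
  shows "poly (det (mat r r (\<lambda>(i, j). f i j))) x = det (mat r r (\<lambda>(i, j). poly (f i j) x))"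
proof -
  have "poly (signof p) x = signof p" for p :: "nat \<Rightarrow> nat"
    by (simp add: sign_def)
  then show ?thesis unfolding det_mat_permutes by (simp add: poly_sum poly_prod)
qed

text \<open>Up to powers of the variable, \<open>r\<close> and \<open>reflect_poly p\<close> agree: cross-multiplied by these
  powers, they take the same values at all positive reals.\<close>

lemma nonneg_coeffs_reversal:
  assumes p: "nonneg_coeffs p" and r: "\<And>x. x \<noteq> 0 \<Longrightarrow> poly r x = x ^ N * poly p (1 / x)"
  shows "nonneg_coeffs r"
proof -
  let ?d = "degree p"
  have "monom 1 ?d * r = monom 1 N * reflect_poly p"
  proof (rule ccontr)
    assume "monom 1 ?d * r \<noteq> monom 1 N * reflect_poly p"
    then have "finite {x. poly (monom 1 ?d * r - monom 1 N * reflect_poly p) x = 0}"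
      by (intro poly_roots_finite) simp
    moreover have "{0<..} \<subseteq> {x. poly (monom 1 ?d * r - monom 1 N * reflect_poly p) x = 0}"
      by (auto simp: poly_monom poly_reflect_poly_nz r inverse_eq_divide)
    ultimately show False using infinite_Ioi finite_subset by blast
  qed
  moreover have "coeff r k = coeff (monom 1 ?d * r) (?d + k)" for k
    by (simp add: coeff_monom_mult)
  moreover have "nonneg_coeffs (monom 1 N * reflect_poly p)"
    using p by (auto simp: nonneg_coeffs_def coeff_monom_mult coeff_reflect_poly)
  ultimately show ?thesis by (simp add: nonneg_coeffs_def)
qed

text \<open>In a Hankel minor of the reversed polynomials, the powers of \<open>q\<close> come out of the rows and
  columns, and what remains is the corresponding minor of the original ones at \<open>1 / q\<close>.\<close>

lemma q_Stieltjes_moment_signless_laguerre_rev: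
  assumes "-1 \<le> \<alpha>"
  shows "q_Stieltjes_moment (signless_laguerre_rev \<alpha>)"
  unfolding q_Stieltjes_moment_def
proof
  fix d assume "d \<in> minors (\<lambda>i j. signless_laguerre_rev \<alpha> (i + j))"
  then obtain r \<rho> \<sigma> where d: "d = det (mat r r (\<lambda>(i, j). signless_laguerre_rev \<alpha> (\<rho> i + \<sigma> j)))"
    and *: "strict_mono_on {..<r} \<rho>" "strict_mono_on {..<r} \<sigma>"
    unfolding minors_def by auto
  define e where "e = det (mat r r (\<lambda>(i, j). signless_laguerre \<alpha> (\<rho> i + \<sigma> j)))"
  have e: "nonneg_coeffs e"
    using q_Stieltjes_moment_signless_laguerre[OF assms] * unfolding q_Stieltjes_moment_def minors_def e_def by blast
  show "nonneg_coeffs d"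
  proof (rule nonneg_coeffs_reversal[OF e])
    fix x :: real assume x: "x \<noteq> 0"
    have "poly d x = det (mat r r (\<lambda>(i, j). x ^ \<rho> i * x ^ \<sigma> j * poly (signless_laguerre \<alpha> (\<rho> i + \<sigma> j)) (1 / x)))"
      unfolding d poly_det by (simp add: poly_signless_laguerre_rev[OF x] power_add)
    also have "\<dots> = x ^ (sum \<rho> {0..<r} + sum \<sigma> {0..<r}) * poly e (1 / x)"
      unfolding det_scale_rows_columns e_def poly_det by (simp add: power_add power_sum)
    finally show "poly d x = x ^ (sum \<rho> {0..<r} + sum \<sigma> {0..<r}) * poly e (1 / x)" .
  qed
qed

section \<open>Poisson mixtures of gamma distributions\<close>

lemma pochhammer_nonneg_real: "0 \<le> (s :: real) \<Longrightarrow> 0 \<le> pochhammer s n"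
  by (simp add: pochhammer_prod prod_nonneg)

text \<open>The Laguerre coefficients convert rising factorials of \<open>m + \<alpha> + 1\<close> into falling factorials
  of \<open>m\<close>, written here as \<open>k! * (m choose k)\<close>: this is Vandermonde's convolution for
  \<open>(m + (n + \<alpha>)) gchoose n\<close>.\<close>

lemma pochhammer_eq_sum_laguerre_coeff:
  "pochhammer (real m + \<alpha> + 1) n = (\<Sum>k\<le>n. laguerre_coeff \<alpha> n k * (fact k * real (m choose k)))"
proof -
  have "pochhammer (real m + \<alpha> + 1) n = fact n * ((real m + (real n + \<alpha>)) gchoose n)"
    by (simp add: gbinomial_pochhammer' algebra_simps)
  also have "\<dots> = (\<Sum>k\<le>n. fact n * ((real m gchoose k) * ((real n + \<alpha>) gchoose (n - k))))"
    by (simp flip: gbinomial_Vandermonde add: atLeast0AtMost sum_distrib_left)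
  also have "\<dots> = (\<Sum>k\<le>n. laguerre_coeff \<alpha> n k * (fact k * real (m choose k)))"
    by (rule sum.cong)
       (auto simp: laguerre_coeff_def int_gbinomial_def nat_diff_distrib simp flip: binomial_gbinomial)
  finally show ?thesis .
qed

lemma poisson_factorial_moment:
  fixes q :: real
  shows "(\<lambda>m. exp (- q) * q ^ m / fact m * (fact k * real (m choose k))) sums q ^ k"
proof -
  have "(\<lambda>m. q ^ k * exp (- q) * (q ^ m /\<^sub>R fact m)) sums (q ^ k * exp (- q) * exp q)"
    by (intro sums_mult exp_converges)
  also have "(\<lambda>m. q ^ k * exp (- q) * (q ^ m /\<^sub>R fact m)) =
      (\<lambda>m. exp (- q) * q ^ (m + k) / fact (m + k) * (fact k * real ((m + k) choose k)))"
    by (auto simp: fun_eq_iff binomial_fact power_add field_simps)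
  also have "q ^ k * exp (- q) * exp q = q ^ k"
    by (simp add: exp_minus)
  finally show ?thesis
    by (subst (asm) sums_zero_iff_shift) (auto simp: binomial_eq_0)
qed

text \<open>A Dobinski formula. The rising factorial \<open>pochhammer s n\<close> is the \<open>n\<close>-th moment of the
  gamma distribution with shape \<open>s\<close>. So, for \<open>\<alpha> \<ge> -1\<close> and \<open>q \<ge> 0\<close>,
  \<open>L\<^sub>n(q)\<close> is the \<open>n\<close>-th moment of a gamma variable whose
  shape is \<open>\<alpha> + 1\<close> plus a Poisson variable with mean \<open>q\<close>.\<close>

lemma dobinski_laguerre:
  "(\<lambda>m. exp (- q) * q ^ m / fact m * pochhammer (real m + \<alpha> + 1) n) sums
     (\<Sum>k\<le>n. laguerre_coeff \<alpha> n k * q ^ k)"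
proof -
  have "(\<lambda>m. \<Sum>k\<le>n. laguerre_coeff \<alpha> n k * (exp (- q) * q ^ m / fact m * (fact k * real (m choose k)))) sums
      (\<Sum>k\<le>n. laguerre_coeff \<alpha> n k * q ^ k)"
    by (intro sums_sum sums_mult poisson_factorial_moment)
  then show ?thesis
    by (simp add: pochhammer_eq_sum_laguerre_coeff sum_distrib_left mult_ac)
qed

text \<open>A gamma variable with shape \<open>s\<close> is presented as \<open>gamma_value s g\<close> with \<open>g\<close> distributed
  according to \<open>gamma_density s\<close>. For \<open>s > 0\<close> this is the usual density. The shape \<open>s = 0\<close>, which
  occurs for \<open>\<alpha> = -1\<close>, stands for the point mass at \<open>0\<close>: there the density is that of an
  auxiliary exponential variable, and the value is constantly \<open>0\<close>.\<close>

definition gamma_density :: "real \<Rightarrow> real \<Rightarrow> real" where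
  "gamma_density s g = (if g \<le> 0 then 0 else if s = 0 then exp (- g) else g powr (s - 1) * exp (- g) / Gamma s)"

definition gamma_value :: "real \<Rightarrow> real \<Rightarrow> real" where
  "gamma_value s g = (if s = 0 then 0 else \<bar>g\<bar>)"

lemma gamma_density_nonneg: "0 \<le> s \<Longrightarrow> 0 \<le> gamma_density s g"
  by (simp add: gamma_density_def Gamma_real_nonneg)

lemma measurable_gamma [measurable]:
  "gamma_density s \<in> borel_measurable borel" "gamma_value s \<in> borel_measurable borel"
  unfolding gamma_density_def[abs_def] gamma_value_def[abs_def] by measurable

lemma nn_integral_Gamma:
  assumes "0 < s"
  shows "(\<integral>\<^sup>+ g. ennreal (if g \<le> 0 then 0 else g powr (s - 1) * exp (- g)) \<partial>lborel) = ennreal (Gamma s)"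
proof -
  have "(\<integral>\<^sup>+ g. ennreal (g powr (s - 1) / exp g) * indicator {0..} g \<partial>lborel) = ennreal (Gamma s)"
    by (rule nn_integral_has_integral_lebesgue') (use Gamma_integral_real[OF assms] in auto)
  also have "(\<integral>\<^sup>+ g. ennreal (g powr (s - 1) / exp g) * indicator {0..} g \<partial>lborel) =
      (\<integral>\<^sup>+ g. ennreal (if g \<le> 0 then 0 else g powr (s - 1) * exp (- g)) \<partial>lborel)"
    by (rule nn_integral_cong) (auto simp: indicator_def exp_minus divide_inverse)
  finally show ?thesis .
qed

lemma gamma_moment:
  assumes s: "0 \<le> s"
  shows "(\<integral>\<^sup>+ g. ennreal (gamma_density s g * gamma_value s g ^ k) \<partial>lborel) = ennreal (pochhammer s k)"
proof (cases "s = 0")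
  case True
  have "(\<integral>\<^sup>+ g. ennreal (gamma_density s g * gamma_value s g ^ k) \<partial>lborel) =
      (\<integral>\<^sup>+ g. ennreal (0 ^ k) * ennreal (if g \<le> 0 then 0 else g powr (1 - 1) * exp (- g)) \<partial>lborel)"
    by (rule nn_integral_cong) (auto simp: gamma_density_def gamma_value_def True power_0_left)
  also have "\<dots> = ennreal (0 ^ k)"
    by (subst nn_integral_cmult) (simp_all add: nn_integral_Gamma del: diff_self)
  also have "(0 :: real) ^ k = pochhammer s k"
    by (cases k) (simp_all add: True pochhammer_rec)
  finally show ?thesis .
next
  case False
  then have pos: "0 < s" using s by simp
  have "(\<integral>\<^sup>+ g. ennreal (gamma_density s g * gamma_value s g ^ k) \<partial>lborel) =
      (\<integral>\<^sup>+ g. ennreal (1 / Gamma s) * ennreal (if g \<le> 0 then 0 else g powr (s + real k - 1) * exp (- g)) \<partial>lborel)"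
  proof (rule nn_integral_cong)
    fix g :: real
    have "g powr (s + real k - 1) = g powr (s - 1) * g ^ k" if "g > 0"
      using that by (simp add: powr_add powr_diff powr_realpow)
    then show "ennreal (gamma_density s g * gamma_value s g ^ k) =
        ennreal (1 / Gamma s) * ennreal (if g \<le> 0 then 0 else g powr (s + real k - 1) * exp (- g))"
      using pos Gamma_real_pos[OF pos]
      by (auto simp: gamma_density_def gamma_value_def mult_ac simp flip: ennreal_mult)
  qed
  also have "\<dots> = ennreal (1 / Gamma s) * ennreal (Gamma (s + real k))"
    using pos by (subst nn_integral_cmult) (simp_all add: nn_integral_Gamma)
  also have "\<dots> = ennreal (pochhammer s k)"
  proof -
    have "s \<notin> \<int>\<^sub>\<le>\<^sub>0" using pos by (auto elim!: nonpos_Ints_cases)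
    then have "pochhammer s k = 1 / Gamma s * Gamma (s + real k)" by (simp add: pochhammer_Gamma)
    then show ?thesis using pos by (simp add: ennreal_mult Gamma_real_nonneg del: times_divide_eq_left)
  qed
  finally show ?thesis .
qed

section \<open>The convolution\<close>

lemma Stieltjes_measure:
  assumes sets: "sets \<mu> = sets (restrict_space borel {0::real..})"
    and mom: "\<And>k. has_bochner_integral \<mu> (\<lambda>x. x ^ k) (a k)"
  shows "space \<mu> = {0..}" "(\<lambda>x. x) \<in> borel_measurable \<mu>" "sigma_finite_measure \<mu>"
    "0 \<le> a k" "(\<integral>\<^sup>+ x. ennreal (x ^ k) \<partial>\<mu>) = ennreal (a k)"
proof -
  show sp: "space \<mu> = {0..}"
    using sets_eq_imp_space_eq[OF sets] by (simp add: space_restrict_space)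
  show "(\<lambda>x. x) \<in> borel_measurable \<mu>"
    unfolding measurable_cong_sets[OF sets refl] by (rule measurable_restrict_space1) simp
  have one: "has_bochner_integral \<mu> (\<lambda>x. 1 :: real) (a 0)" using mom[of 0] by simp
  have "(\<integral>\<^sup>+ x. ennreal 1 \<partial>\<mu>) = ennreal (a 0)"
    using nn_integral_eq_integral[of \<mu> "\<lambda>_. 1 :: real"] one by (simp add: has_bochner_integral_iff)
  then have "emeasure \<mu> (space \<mu>) \<noteq> \<infinity>" by simp
  then interpret finite_measure \<mu> by (rule finite_measureI)
  show "sigma_finite_measure \<mu>" by unfold_locales
  have nn: "AE x in \<mu>. 0 \<le> x ^ k" by (rule AE_I2) (simp add: sp)
  have I: "integrable \<mu> (\<lambda>x. x ^ k)" "(\<integral>x. x ^ k \<partial>\<mu>) = a k"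
    using mom[of k] by (simp_all add: has_bochner_integral_iff)
  show "0 \<le> a k" using integral_nonneg_AE[OF nn] I by simp
  show "(\<integral>\<^sup>+ x. ennreal (x ^ k) \<partial>\<mu>) = ennreal (a k)"
    using nn_integral_eq_integral[OF I(1) nn] I(2) by simp
qed

text \<open>For fixed \<open>x \<ge> 0\<close> and \<open>y > 0\<close>, the law with moments \<open>y\<^sup>n L\<^sub>n(x / y)\<close>: draw \<open>m\<close> from the Poisson
  distribution with mean \<open>x / y\<close>, then a gamma variable of shape \<open>m + \<alpha> + 1\<close>, and multiply it by
  \<open>y\<close>. The homogenised polynomial is \<open>x\<^sup>n\<close> at \<open>y = 0\<close>, so there the law is the point mass at
  \<open>x\<close>, carried by \<open>m = 0\<close> and an auxiliary exponential variable.\<close>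

definition mix_weight :: "real \<Rightarrow> real \<Rightarrow> real \<Rightarrow> nat \<Rightarrow> real \<Rightarrow> real" where
  "mix_weight \<alpha> x y m g =
     (if y = 0 then (if m = 0 then gamma_density 0 g else 0)
      else exp (- (x / y)) * (x / y) ^ m / fact m * gamma_density (real m + \<alpha> + 1) g)"

definition mix_value :: "real \<Rightarrow> real \<Rightarrow> real \<Rightarrow> nat \<Rightarrow> real \<Rightarrow> real" where
  "mix_value \<alpha> x y m g = (if y = 0 then x else y * gamma_value (real m + \<alpha> + 1) g)"

context
  fixes \<alpha> :: real
  assumes \<alpha>: "-1 \<le> \<alpha>"
begin

lemma mix_weight_nonneg: "0 \<le> x \<Longrightarrow> 0 \<le> y \<Longrightarrow> 0 \<le> mix_weight \<alpha> x y m g"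
  using \<alpha> by (auto simp: mix_weight_def gamma_density_nonneg)

lemma mix_value_nonneg: "0 \<le> x \<Longrightarrow> 0 \<le> y \<Longrightarrow> 0 \<le> mix_value \<alpha> x y m g"
  by (auto simp: mix_value_def gamma_value_def)

lemma laguerre_coeff_nonneg: "0 \<le> laguerre_coeff \<alpha> n k"
  using \<alpha> by (auto simp: laguerre_coeff_eq_pochhammer intro!: mult_nonneg_nonneg pochhammer_nonneg_real)

lemma mix_moment:
  assumes x: "0 \<le> x" and y: "0 \<le> y"
  shows "(\<integral>\<^sup>+ m. (\<integral>\<^sup>+ g. ennreal (mix_weight \<alpha> x y m g * mix_value \<alpha> x y m g ^ n) \<partial>lborel) \<partial>count_space UNIV) =
    ennreal (\<Sum>k\<le>n. laguerre_coeff \<alpha> n k * x ^ k * y ^ (n - k))"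
proof (cases "y = 0")
  case True
  have "(\<integral>\<^sup>+ g. ennreal (mix_weight \<alpha> x y m g * mix_value \<alpha> x y m g ^ n) \<partial>lborel) =
      ennreal (if m = 0 then x ^ n else 0)" for m
  proof -
    have "(\<integral>\<^sup>+ g. ennreal (mix_weight \<alpha> x y m g * mix_value \<alpha> x y m g ^ n) \<partial>lborel) =
       (\<integral>\<^sup>+ g. ennreal (if m = 0 then x ^ n else 0) * ennreal (gamma_density 0 g * gamma_value 0 g ^ 0) \<partial>lborel)"
      using x by (intro nn_integral_cong) (auto simp: mix_weight_def mix_value_def True mult.commute gamma_density_nonneg simp flip: ennreal_mult)
    also have "\<dots> = ennreal (if m = 0 then x ^ n else 0)"
      by (subst nn_integral_cmult) (simp_all add: gamma_moment del: power_0)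
    finally show ?thesis .
  qed
  then have "(\<integral>\<^sup>+ m. (\<integral>\<^sup>+ g. ennreal (mix_weight \<alpha> x y m g * mix_value \<alpha> x y m g ^ n) \<partial>lborel) \<partial>count_space UNIV) =
      (\<Sum>m. ennreal (if m = 0 then x ^ n else 0))"
    by (simp add: nn_integral_count_space_nat)
  also have "\<dots> = ennreal (x ^ n)"
  proof (rule suminf_ennreal_eq)
    show "(\<lambda>m. if m = 0 then x ^ n else 0) sums (x ^ n)"
      using sums_single[of 0 "\<lambda>_. x ^ n"] by simp
  qed (use x in auto)
  also have "(\<Sum>k\<le>n. laguerre_coeff \<alpha> n k * x ^ k * y ^ (n - k)) = (\<Sum>k\<le>n. if k = n then x ^ n else 0)"
    by (rule sum.cong) (auto simp: True laguerre_coeff_eq_pochhammer power_0_left)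
  then have "x ^ n = (\<Sum>k\<le>n. laguerre_coeff \<alpha> n k * x ^ k * y ^ (n - k))" by simp
  finally show ?thesis .
next
  case False
  then have y0: "0 < y" using y by simp
  have "(\<integral>\<^sup>+ g. ennreal (mix_weight \<alpha> x y m g * mix_value \<alpha> x y m g ^ n) \<partial>lborel) =
      ennreal (y ^ n * (exp (- (x / y)) * (x / y) ^ m / fact m * pochhammer (real m + \<alpha> + 1) n))" for m
  proof -
    have s: "0 \<le> real m + \<alpha> + 1" using \<alpha> by simp
    have "(\<integral>\<^sup>+ g. ennreal (mix_weight \<alpha> x y m g * mix_value \<alpha> x y m g ^ n) \<partial>lborel) =
       (\<integral>\<^sup>+ g. ennreal (y ^ n * (exp (- (x / y)) * (x / y) ^ m / fact m)) *
          ennreal (gamma_density (real m + \<alpha> + 1) g * gamma_value (real m + \<alpha> + 1) g ^ n) \<partial>lborel)"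
    proof (rule nn_integral_cong)
      fix g :: real
      let ?c = "exp (- (x / y)) * (x / y) ^ m / fact m"
      let ?D = "gamma_density (real m + \<alpha> + 1) g" and ?V = "gamma_value (real m + \<alpha> + 1) g"
      have "mix_weight \<alpha> x y m g * mix_value \<alpha> x y m g ^ n = (?c * ?D) * (y * ?V) ^ n"
        using y0 by (simp add: mix_weight_def mix_value_def)
      also have "\<dots> = (y ^ n * ?c) * (?D * ?V ^ n)"
        by (simp only: power_mult_distrib mult_ac)
      finally have "mix_weight \<alpha> x y m g * mix_value \<alpha> x y m g ^ n = (y ^ n * ?c) * (?D * ?V ^ n)" .
      moreover have "0 \<le> y ^ n * ?c" using x y0 by simp
      moreover have "0 \<le> ?D * ?V ^ n"
        by (intro mult_nonneg_nonneg gamma_density_nonneg zero_le_power s) (simp add: gamma_value_def)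
      ultimately show "ennreal (mix_weight \<alpha> x y m g * mix_value \<alpha> x y m g ^ n) =
          ennreal (y ^ n * ?c) * ennreal (?D * ?V ^ n)"
        by (simp only: ennreal_mult)
    qed
    also have "\<dots> = ennreal (y ^ n * (exp (- (x / y)) * (x / y) ^ m / fact m)) * ennreal (pochhammer (real m + \<alpha> + 1) n)"
      by (subst nn_integral_cmult) (simp_all add: gamma_moment[OF s])
    also have "\<dots> = ennreal (y ^ n * (exp (- (x / y)) * (x / y) ^ m / fact m) * pochhammer (real m + \<alpha> + 1) n)"
      using x y0 s by (intro ennreal_mult[symmetric] pochhammer_nonneg_real) auto
    finally show ?thesis by (simp only: mult.assoc)
  qed
  then have "(\<integral>\<^sup>+ m. (\<integral>\<^sup>+ g. ennreal (mix_weight \<alpha> x y m g * mix_value \<alpha> x y m g ^ n) \<partial>lborel) \<partial>count_space UNIV) =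
      (\<Sum>m. ennreal (y ^ n * (exp (- (x / y)) * (x / y) ^ m / fact m * pochhammer (real m + \<alpha> + 1) n)))"
    by (simp add: nn_integral_count_space_nat)
  also have "\<dots> = ennreal (y ^ n * (\<Sum>k\<le>n. laguerre_coeff \<alpha> n k * (x / y) ^ k))"
  proof (rule suminf_ennreal_eq)
    show "(\<lambda>m. y ^ n * (exp (- (x / y)) * (x / y) ^ m / fact m * pochhammer (real m + \<alpha> + 1) n)) sums
        (y ^ n * (\<Sum>k\<le>n. laguerre_coeff \<alpha> n k * (x / y) ^ k))"
      by (intro sums_mult dobinski_laguerre)
    show "0 \<le> y ^ n * (exp (- (x / y)) * (x / y) ^ m / fact m * pochhammer (real m + \<alpha> + 1) n)" for m
      using x y0 \<alpha> by (auto intro!: mult_nonneg_nonneg pochhammer_nonneg_real divide_nonneg_nonneg)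
  qed
  also have "y ^ n * (\<Sum>k\<le>n. laguerre_coeff \<alpha> n k * (x / y) ^ k) = (\<Sum>k\<le>n. laguerre_coeff \<alpha> n k * x ^ k * y ^ (n - k))"
    using y0 by (auto simp: sum_distrib_left power_divide power_diff intro!: sum.cong)
  finally show ?thesis .
qed

text \<open>If \<open>a\<close> and \<open>b\<close> are the moments of \<open>\<mu>\<close> and \<open>\<nu>\<close>, then the \<open>n\<close>-th term of the convolution is
  the integral of \<open>\<Sum>k\<le>n. laguerre_coeff \<alpha> n k * x ^ k * y ^ (n - k)\<close> over \<open>\<mu> \<Otimes>\<^sub>M \<nu>\<close>, and the
  integrand is the \<open>n\<close>-th moment of the law above. So the measure for the convolution is the mixture
  of these laws over \<open>\<mu> \<Otimes>\<^sub>M \<nu>\<close>. It is built as the image of a single product measure with a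
  density: Tonelli's theorem then computes its moments, without treating the laws as a kernel in
  \<open>x\<close> and \<open>y\<close>.\<close>

lemma convolution_preserves_SM_laguerre_coeff: "convolution_preserves_SM (laguerre_coeff \<alpha>)"
  unfolding convolution_preserves_SM_def
proof (intro allI impI)
  fix a b :: "nat \<Rightarrow> real"
  assume "Stieltjes_moment a" "Stieltjes_moment b"
  then obtain \<mu> \<nu> where sets\<mu>: "sets \<mu> = sets (restrict_space borel {0::real..})"
    and mom\<mu>: "\<And>k. has_bochner_integral \<mu> (\<lambda>x. x ^ k) (a k)"
    and sets\<nu>: "sets \<nu> = sets (restrict_space borel {0::real..})"
    and mom\<nu>: "\<And>k. has_bochner_integral \<nu> (\<lambda>x. x ^ k) (b k)"
    unfolding Stieltjes_moment_def by blast
  note \<mu> = Stieltjes_measure[OF sets\<mu> mom\<mu>] and \<nu> = Stieltjes_measure[OF sets\<nu> mom\<nu>]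
  note [measurable] = \<mu>(2) \<nu>(2)
  interpret \<nu>: sigma_finite_measure \<nu> by (rule \<nu>(3))
  interpret C: sigma_finite_measure "count_space (UNIV :: nat set)"
    by (rule sigma_finite_measure_count_space)
  define \<Omega> where "\<Omega> = ((\<mu> \<Otimes>\<^sub>M \<nu>) \<Otimes>\<^sub>M count_space (UNIV :: nat set)) \<Otimes>\<^sub>M (lborel :: real measure)"
  define W where "W \<omega> = mix_weight \<alpha> (fst (fst (fst \<omega>))) (snd (fst (fst \<omega>))) (snd (fst \<omega>)) (snd \<omega>)"
    for \<omega> :: "((real \<times> real) \<times> nat) \<times> real"
  define Z where "Z \<omega> = mix_value \<alpha> (fst (fst (fst \<omega>))) (snd (fst (fst \<omega>))) (snd (fst \<omega>)) (snd \<omega>)"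
    for \<omega> :: "((real \<times> real) \<times> nat) \<times> real"
  have X [measurable]: "(\<lambda>\<omega>. fst (fst (fst \<omega>))) \<in> borel_measurable \<Omega>"
    and Y [measurable]: "(\<lambda>\<omega>. snd (fst (fst \<omega>))) \<in> borel_measurable \<Omega>"
    and N: "(\<lambda>\<omega>. snd (fst \<omega>)) \<in> measurable \<Omega> (count_space UNIV)"
    and G [measurable]: "(\<lambda>\<omega>. snd \<omega>) \<in> borel_measurable \<Omega>"
    unfolding \<Omega>_def by measurable
  \<comment> \<open>The number \<open>m\<close> is discrete, so measurability can be checked for each fixed value of it.\<close>
  have W_meas [measurable]: "W \<in> borel_measurable \<Omega>"
    unfolding W_def[abs_def] by (rule measurable_compose_countable[OF _ N]) (unfold mix_weight_def, measurable)
  have Z_meas [measurable]: "Z \<in> borel_measurable \<Omega>"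
    unfolding Z_def[abs_def] by (rule measurable_compose_countable[OF _ N]) (unfold mix_value_def, measurable)
  have "space \<Omega> = (({0..} \<times> {0..}) \<times> UNIV) \<times> UNIV"
    by (simp add: \<Omega>_def space_pair_measure \<mu>(1) \<nu>(1))
  then have space: "0 \<le> fst (fst (fst \<omega>))" "0 \<le> snd (fst (fst \<omega>))" if "\<omega> \<in> space \<Omega>" for \<omega>
    using that by (simp_all add: mem_Times_iff)
  have Z_meas' [measurable]: "Z \<in> measurable \<Omega> (restrict_space borel {0..})"
    by (rule measurable_restrict_space2) (auto simp: Z_def mix_value_nonneg space)
  define \<eta> where "\<eta> = distr (density \<Omega> (\<lambda>\<omega>. ennreal (W \<omega>))) (restrict_space borel {0..}) Z"
  have "has_bochner_integral \<eta> (\<lambda>z. z ^ n) (convolution (laguerre_coeff \<alpha>) a b n)" for n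
  proof (rule has_bochner_integral_nn_integral)
    have id: "(\<lambda>z. z) \<in> borel_measurable (restrict_space borel {0::real..})"
      by (rule measurable_restrict_space1) simp
    show meas: "(\<lambda>z. z ^ n) \<in> borel_measurable \<eta>"
      using borel_measurable_power[OF id, of n] by (simp add: \<eta>_def)
    show "AE z in \<eta>. 0 \<le> z ^ n"
      by (rule AE_I2) (simp add: \<eta>_def space_restrict_space)
    show "0 \<le> convolution (laguerre_coeff \<alpha>) a b n"
      unfolding convolution_def by (intro sum_nonneg mult_nonneg_nonneg laguerre_coeff_nonneg \<mu>(4) \<nu>(4))
    have "(\<integral>\<^sup>+ z. ennreal (z ^ n) \<partial>\<eta>) = (\<integral>\<^sup>+ \<omega>. ennreal (W \<omega>) * ennreal (Z \<omega> ^ n) \<partial>\<Omega>)"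
      unfolding \<eta>_def using borel_measurable_power[OF id, of n]
      by (subst nn_integral_distr) (simp_all add: nn_integral_density)
    also have "\<dots> = (\<integral>\<^sup>+ \<omega>. ennreal (W \<omega> * Z \<omega> ^ n) \<partial>\<Omega>)"
      by (rule nn_integral_cong) (simp add: ennreal_mult W_def Z_def mix_weight_nonneg mix_value_nonneg space)
    also have "\<dots> = (\<integral>\<^sup>+ p. \<integral>\<^sup>+ m. \<integral>\<^sup>+ g. ennreal (W ((p, m), g) * Z ((p, m), g) ^ n)
        \<partial>lborel \<partial>count_space UNIV \<partial>(\<mu> \<Otimes>\<^sub>M \<nu>))"
    proof -
      have m: "(\<lambda>\<omega>. ennreal (W \<omega> * Z \<omega> ^ n)) \<in> borel_measurable \<Omega>" by measurable
      show ?thesis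
        using m unfolding \<Omega>_def
        by (subst lborel.nn_integral_fst[symmetric], simp, subst C.nn_integral_fst[symmetric])
           (simp_all add: lborel.borel_measurable_nn_integral_fst)
    qed
    also have "\<dots> = (\<integral>\<^sup>+ p. ennreal (\<Sum>k\<le>n. laguerre_coeff \<alpha> n k * fst p ^ k * snd p ^ (n - k)) \<partial>(\<mu> \<Otimes>\<^sub>M \<nu>))"
      by (rule nn_integral_cong)
         (simp add: W_def Z_def mix_moment space_pair_measure mem_Times_iff \<mu>(1) \<nu>(1))
    also have "\<dots> = (\<integral>\<^sup>+ p. (\<Sum>k\<le>n. ennreal (laguerre_coeff \<alpha> n k) * (ennreal (fst p ^ k) * ennreal (snd p ^ (n - k)))) \<partial>(\<mu> \<Otimes>\<^sub>M \<nu>))"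
      by (rule nn_integral_cong)
         (simp add: space_pair_measure mem_Times_iff \<mu>(1) \<nu>(1) mult.assoc laguerre_coeff_nonneg
           flip: ennreal_mult)
    also have "\<dots> = (\<Sum>k\<le>n. ennreal (laguerre_coeff \<alpha> n k) *
        (\<integral>\<^sup>+ p. ennreal (fst p ^ k) * ennreal (snd p ^ (n - k)) \<partial>(\<mu> \<Otimes>\<^sub>M \<nu>)))"
      by (subst nn_integral_sum) (auto simp: nn_integral_cmult)
    also have "\<dots> = (\<Sum>k\<le>n. ennreal (laguerre_coeff \<alpha> n k) * (ennreal (a k) * ennreal (b (n - k))))"
    proof (rule sum.cong[OF refl])
      fix k
      have "(\<integral>\<^sup>+ p. ennreal (fst p ^ k) * ennreal (snd p ^ (n - k)) \<partial>(\<mu> \<Otimes>\<^sub>M \<nu>)) =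
          (\<integral>\<^sup>+ x. \<integral>\<^sup>+ y. ennreal (x ^ k) * ennreal (y ^ (n - k)) \<partial>\<nu> \<partial>\<mu>)"
        by (subst \<nu>.nn_integral_fst[symmetric]) simp_all
      also have "\<dots> = ennreal (a k) * ennreal (b (n - k))"
        by (simp add: nn_integral_cmult nn_integral_multc \<mu>(5) \<nu>(5))
      finally show "ennreal (laguerre_coeff \<alpha> n k) * (\<integral>\<^sup>+ p. ennreal (fst p ^ k) * ennreal (snd p ^ (n - k)) \<partial>(\<mu> \<Otimes>\<^sub>M \<nu>)) =
          ennreal (laguerre_coeff \<alpha> n k) * (ennreal (a k) * ennreal (b (n - k)))"
        by simp
    qed
    also have "\<dots> = ennreal (convolution (laguerre_coeff \<alpha>) a b n)"
      unfolding convolution_def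
      by (simp add: mult.assoc laguerre_coeff_nonneg \<mu>(4) \<nu>(4) flip: ennreal_mult)
    finally show "(\<integral>\<^sup>+ z. ennreal (z ^ n) \<partial>\<eta>) = ennreal (convolution (laguerre_coeff \<alpha>) a b n)" .
  qed
  moreover have "sets \<eta> = sets (restrict_space borel {0..})" by (simp add: \<eta>_def)
  ultimately show "Stieltjes_moment (convolution (laguerre_coeff \<alpha>) a b)"
    unfolding Stieltjes_moment_def by blast
qed

end

section \<open>The proposition\<close>

theorem proposition4p14:
  fixes \<alpha> :: real
  assumes "\<alpha> \<ge> -1"
  shows "(q_Stieltjes_moment (signless_laguerre \<alpha>) \<and> three_q_log_convex (signless_laguerre \<alpha>) \<and>
          q_Stieltjes_moment (signless_laguerre_rev \<alpha>) \<and>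
          three_q_log_convex (signless_laguerre_rev \<alpha>)) \<and>
         totally_positive (laguerre_coeff \<alpha>) \<and>
         convolution_preserves_SM (laguerre_coeff \<alpha>)"
  using assms q_Stieltjes_moment_signless_laguerre q_Stieltjes_moment_signless_laguerre_rev
    three_q_log_convex_if_q_Stieltjes_moment totally_positive_laguerre_coeff
    convolution_preserves_SM_laguerre_coeff
  by simp

end
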